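(* Let $\Gamma=(X_i,A_i,P_i,B_i)_{i\in I}$ be an abstract economy, where $I$ is a (possibly uncountable) non-empty set of agents, and put $X=\prod_{i\in I}X_i$. Suppose that for each $i\in I$: (1) $X_i$ is a non-empty convex set in a Hausdorff locally convex space $E_i$ and there exists a non-empty compact metrizable subset $D_i$ of $X_i$ containing all values of the correspondences $A_i$, $P_i$ and $B_i$; (2) $\operatorname{cl}B_i$ is lower semicontinuous with non-empty convex values; (3) there exists an $(n_i-1)$-dimensional simplex $K_i$ in $X$ (for some positive integer $n_i$) such that $W_i:=\{x\in X:(A_i\cap P_i)(x)\neq\emptyset\}\subset\operatorname{int}_X(K_i)$; (4) $\operatorname{cl}B_i$ has the WNQS-property on $K_i$. Then there exists an equilibrium point $\overline{x}\in D=\prod_{i\in I}D_i$ for $\Gamma$, i.e. a point $\overline{x}\in D$ such that for each $i\in I$, $\overline{x}_i\in\operatorname{cl}B_i(\overline{x})$ and $A_i(\overline{x})\cap P_i(\overline{x})=\emptyset$.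
   Context: An abstract economy $\Gamma=(X_i,A_i,P_i,B_i)_{i\in I}$ consists of a set $I$ of agents and, for each $i\in I$, a set of actions $X_i$, constraint correspondences $A_i,B_i:X\to 2^{X_i}$ and a preference correspondence $P_i:X\to 2^{X_i}$, where $X=\prod_{i\in I}X_i$ (product topology) and $2^{X_i}$ is the family of all subsets of $X_i$. For $x\in X$, $x_i$ is its $i$-th coordinate. $(\operatorname{cl}B_i)(x)=\operatorname{cl}B_i(x)$ is the closure of $B_i(x)$ (in $X_i$); $(A_i\cap P_i)(x)=A_i(x)\cap P_i(x)$; $\operatorname{int}_X$ denotes interior in $X$. A correspondence $T:X\to 2^Y$ is lower semicontinuous if for each $x\in X$ and each open $V\subset Y$ with $T(x)\cap V\ne\emptyset$ there is an open neighborhood $U$ of $x$ with $T(y)\cap V\neq\emptyset$ for all $y\in U$. An $(n-1)$-dimensional simplex is the convex hull of $n$ affinely independent points. Let $\Delta_{n-1}=\{(\lambda_1,\dots,\lambda_n)\in\mathbb{R}^n:\sum_{i=1}^n\lambda_i=1,\ \lambda_i\ge 0 \text{ for all } i\}$. Weakly naturally quasi-concave (WNQ): let $Z$ be a non-empty convex subset of a topological vector space and $Y$ a non-empty subset of a topological vector space. A correspondence $T:Z\to 2^{Y}$ is weakly naturally quasi-concave if for each $n$ and each finite set $\{x_1,\dots,x_n\}\subset Z$ there exist $y_i\in T(x_i)$ ($i=1,\dots,n$) and continuous functions $g_i:[0,1]\to[0,1]$ with $g_i(0)=0$ and $g_i(1)=1$ ($i=1,\dots,n$) such that $(g_1(\lambda_1),\dots,g_n(\lambda_n))\in\Delta_{n-1}$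 whenever $(\lambda_1,\dots,\lambda_n)\in\Delta_{n-1}$, and such that for every $(\lambda_1,\dots,\lambda_n)\in\Delta_{n-1}$ one has $\sum_{i=1}^n g_i(\lambda_i)y_i\in T\left(\sum_{i=1}^n\lambda_i x_i\right)$. WNQS-property: for $K_i\subset X$, a correspondence $C_i:X\to 2^{X_i}$ has the WNQS-property on $K_i$ if there is a weakly naturally quasi-concave correspondence $T_i:K_i\to 2^{X_i}$ such that $x_i\notin T_i(x)$ and $T_i(x)\subset C_i(x)$ for all $x\in K_i$. *)

theory Defs
  imports "HOL-Analysis.Analysis" "HOL-Library.Function_Algebras"
begin

instantiation "fun" :: (type, real_vector) real_vector
begin

definition scaleR_fun :: "real \<Rightarrow> ('a \<Rightarrow> 'b) \<Rightarrow> 'a \<Rightarrow> 'b"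
  where "scaleR_fun c f = (\<lambda>i. c *\<^sub>R f i)"

instance
  by standard (simp_all add: scaleR_fun_def fun_eq_iff scaleR_add_right scaleR_add_left)

end

(* A real Hausdorff locally convex space is given by its topology; its underlying vector space is
   topspace E, a linear subspace of the ambient type. In this way spaces that differ both as
   vector spaces and as topological spaces can be members of one family. No topology on the
   ambient type itself is involved. *)
definition hausdorff_locally_convex :: "'e::real_vector topology \<Rightarrow> bool"
  where "hausdorff_locally_convex E \<longleftrightarrow>
    subspace (topspace E) \<and>
    continuous_map (prod_topology E E) E (\<lambda>(x, y). x + y) \<and>
    continuous_map (prod_topology euclideanreal E) E (\<lambda>(c, x). c *\<^sub>R x) \<and>
    Hausdorff_space E \<and>
    (\<forall>U. openin E U \<and> 0 \<in> U \<longrightarrow> (\<exists>V. openin E V \<and> 0 \<in> V \<and> convex V \<and> V \<subseteq> U))"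

(* The simplex predicate of HOL-Analysis.Polytope is confined to Euclidean spaces. *)
definition simplex_of_dim :: "nat \<Rightarrow> 'v::real_vector set \<Rightarrow> bool"
  where "simplex_of_dim d S \<longleftrightarrow>
    (\<exists>C. finite C \<and> card C = d + 1 \<and> \<not> affine_dependent C \<and> S = convex hull C)"

(* Points of R^n are functions on nat of which only the values on {1..n} matter. *)
definition unit_simplex :: "nat \<Rightarrow> (nat \<Rightarrow> real) set"
  where "unit_simplex n = {l. (\<Sum>i=1..n. l i) = 1 \<and> (\<forall>i\<in>{1..n}. 0 \<le> l i)}"

(* The points x 1, ..., x n of a finite set are pairwise distinct. *)
definition weakly_naturally_quasi_concave ::
    "'z::real_vector set \<Rightarrow> 'y::real_vector set \<Rightarrow> ('z \<Rightarrow> 'y set) \<Rightarrow> bool"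
  where "weakly_naturally_quasi_concave Z Y T \<longleftrightarrow>
    Z \<noteq> {} \<and> convex Z \<and> Y \<noteq> {} \<and> (\<forall>z\<in>Z. T z \<subseteq> Y) \<and>
    (\<forall>n x. inj_on x {1..n} \<and> x ` {1..n} \<subseteq> Z \<longrightarrow>
      (\<exists>(y :: nat \<Rightarrow> 'y) (g :: nat \<Rightarrow> real \<Rightarrow> real).
        (\<forall>i\<in>{1..n}. y i \<in> T (x i)) \<and>
        (\<forall>i\<in>{1..n}. continuous_on {0..1} (g i) \<and> g i ` {0..1} \<subseteq> {0..1} \<and>
                    g i 0 = 0 \<and> g i 1 = 1) \<and>
        (\<forall>l\<in>unit_simplex n. (\<lambda>i. g i (l i)) \<in> unit_simplex n) \<and>
        (\<forall>l\<in>unit_simplex n.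
          (\<Sum>i=1..n. g i (l i) *\<^sub>R y i) \<in> T (\<Sum>i=1..n. l i *\<^sub>R x i))))"

definition lower_semicontinuous :: "'a topology \<Rightarrow> 'b topology \<Rightarrow> ('a \<Rightarrow> 'b set) \<Rightarrow> bool"
  where "lower_semicontinuous X Y T \<longleftrightarrow>
    (\<forall>x\<in>topspace X. \<forall>V. openin Y V \<and> T x \<inter> V \<noteq> {} \<longrightarrow>
      (\<exists>U. openin X U \<and> x \<in> U \<and> (\<forall>y\<in>U. T y \<inter> V \<noteq> {})))"

(* The set of agents is the type 'i; \<tau> i is the topological space of actions of agent i. *)
definition abstract_economy ::
    "('i \<Rightarrow> 'e topology) \<Rightarrow> ('i \<Rightarrow> ('i \<Rightarrow> 'e) \<Rightarrow> 'e set) \<Rightarrow> ('i \<Rightarrow> ('i \<Rightarrow> 'e) \<Rightarrow> 'e set) \<Rightarrow>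
     ('i \<Rightarrow> ('i \<Rightarrow> 'e) \<Rightarrow> 'e set) \<Rightarrow> bool"
  where "abstract_economy \<tau> A P B \<longleftrightarrow>
    (\<forall>i. \<forall>x\<in>topspace (product_topology \<tau> UNIV).
      A i x \<subseteq> topspace (\<tau> i) \<and> P i x \<subseteq> topspace (\<tau> i) \<and> B i x \<subseteq> topspace (\<tau> i))"

definition equilibrium_point ::
    "('i \<Rightarrow> 'e topology) \<Rightarrow> ('i \<Rightarrow> ('i \<Rightarrow> 'e) \<Rightarrow> 'e set) \<Rightarrow> ('i \<Rightarrow> ('i \<Rightarrow> 'e) \<Rightarrow> 'e set) \<Rightarrow>
     ('i \<Rightarrow> ('i \<Rightarrow> 'e) \<Rightarrow> 'e set) \<Rightarrow> ('i \<Rightarrow> 'e) \<Rightarrow> bool"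
  where "equilibrium_point \<tau> A P B x \<longleftrightarrow>
    x \<in> topspace (product_topology \<tau> UNIV) \<and>
    (\<forall>i. x i \<in> \<tau> i closure_of B i x \<and> A i x \<inter> P i x = {})"

definition WNQS_property ::
    "'i \<Rightarrow> 'e::real_vector set \<Rightarrow> ('i \<Rightarrow> 'e) set \<Rightarrow> (('i \<Rightarrow> 'e) \<Rightarrow> 'e set) \<Rightarrow> bool"
  where "WNQS_property i Xi K C \<longleftrightarrow>
    (\<exists>T. weakly_naturally_quasi_concave K Xi T \<and> (\<forall>x\<in>K. x i \<notin> T x \<and> T x \<subseteq> C x))"

end

theory Submission
  imports Defs
begin

text \<open>
  The idea is to replace each constraint correspondence \<open>cl B i\<close> by a smaller one, \<open>F i\<close>, whose
  fixed points cannot lie in any \<open>K i\<close>. Let \<open>T\<close> be the weakly naturally quasi-concave correspondence on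
  the simplex \<open>K i\<close>. Applying its defining property to the vertices of \<open>K i\<close> and writing a point
  of \<open>K i\<close> in barycentric coordinates \<open>l\<close> gives the continuous selection \<open>f i = (\<Sum>k. g k (l k) *\<^sub>R y k)\<close>
  of \<open>T\<close> (\<open>weakly_naturally_quasi_concave_selection\<close>). Let \<open>F i x\<close> be \<open>{f i x}\<close> on \<open>K i\<close> and \<open>cl B i x\<close>
  elsewhere. Since \<open>K i\<close> is closed, \<open>f i\<close> is continuous and selects from \<open>cl B i\<close>, this is again lower
  semicontinuous with non-empty compact convex values in \<open>D i\<close>. A point \<open>x\<close> with \<open>x i \<in> F i x\<close> for all
  \<open>i\<close> avoids every \<open>K i\<close>, because \<open>f i x \<in> T x\<close> while \<open>x i \<notin> T x\<close>. Hence \<open>x i \<in> cl B i x\<close>, and \<open>x\<close>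
  is outside the set where \<open>A i\<close> and \<open>P i\<close> meet, which is part of \<open>K i\<close>.

  It remains to find such an \<open>x\<close> for an arbitrary family of correspondences of this kind
  (\<open>lsc_family_fixed_point\<close>). Two classical theorems are combined. Michael's theorem turns each \<open>F i\<close>
  into a continuous map. An uncountable product need not be paracompact or even normal, but the
  selections are wanted only on a convex set containing the compact set \<open>D = \<Prod>i. D i\<close>, and there is a
  \<open>\<sigma>\<close>-compact one, \<open>C\<close>. It is Lindelof and regular, hence normal, and normality suffices because the
  range \<open>D i\<close> is compact and metrizable: finite open covers and one fixed sequence of neighbourhoods
  of zero do the whole job (\<open>michael_selection_compact_metrizable\<close>). The selections form a continuous
  map \<open>C \<rightarrow> D \<subseteq> C\<close>, which has a fixed point by the Schauder-Tychonoff theorem for compact maps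
  (\<open>lcs_compact_map_fixed_point\<close>). That theorem reduces to Brouwer's on a standard simplex, because a
  partition of unity on \<open>D\<close> approximates the map by one into the convex hull of finitely many points.
\<close>

section \<open>Brouwer's theorem on a standard simplex\<close>

text \<open>
  Here the coordinates outside \<open>{1..n}\<close> vanish, so that, unlike \<open>unit_simplex n\<close>, this is a compact subset of
  \<open>nat \<Rightarrow> real\<close> whose points are determined by their barycentric coordinates. Indexing by numbers lets
  the dimension be an ordinary natural number instead of a type.
\<close>
definition std_simplex :: "nat \<Rightarrow> (nat \<Rightarrow> real) set"
  where "std_simplex n = {l. (\<forall>i. 0 \<le> l i) \<and> (\<forall>i. i \<notin> {1..n} \<longrightarrow> l i = 0) \<and> (\<Sum>i=1..n. l i) = 1}"

lemma tendsto_fun_componentwise: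
  fixes f :: "'a \<Rightarrow> 'b \<Rightarrow> 'c::topological_space"
  assumes "\<And>i. ((\<lambda>x. f x i) \<longlongrightarrow> l i) F"
  shows "(f \<longlongrightarrow> l) F"
proof -
  have "limitin (product_topology (\<lambda>i. euclidean) UNIV) f l F"
    using assms by (simp add: limitin_componentwise)
  then show ?thesis
    by (metis euclidean_product_topology limitin_canonical_iff)
qed

lemma compact_unit_cube: "compact {x :: 'a \<Rightarrow> real. \<forall>i. x i \<in> {0..1}}"
proof -
  have "compactin (product_topology (\<lambda>i. euclideanreal) UNIV) (Pi\<^sub>E UNIV (\<lambda>i::'a. {0..1::real}))"
    by (simp add: compactin_PiE)
  moreover have "Pi\<^sub>E UNIV (\<lambda>i::'a. {0..1::real}) = {x. \<forall>i. x i \<in> {0..1}}"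
    by auto
  ultimately show ?thesis
    by (metis compactin_euclidean_iff euclidean_product_topology)
qed

text \<open>
  Kuhn's combinatorial lemma is applied to the grids of mesh \<open>1 / Suc p\<close>, where a grid point
  is labelled in direction \<open>i\<close> according to whether \<open>f\<close> moves it up or down in that direction. It
  yields cells that have, for each \<open>i\<close>, a corner not moved down and a corner not moved up in
  direction \<open>i\<close>. A limit point of such cells is moved in none of these directions. The domain is a cube of sequences, in
  order that one compact metrizable space serves every dimension \<open>n\<close>.
\<close>
lemma brouwer_unit_cube:
  fixes f :: "(nat \<Rightarrow> real) \<Rightarrow> nat \<Rightarrow> real"
  defines "Q \<equiv> {x. \<forall>i. x i \<in> {0..1}}"
  assumes cont: "\<And>i. i < n \<Longrightarrow> continuous_on Q (\<lambda>x. f x i)"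
    and into: "\<And>x i. x \<in> Q \<Longrightarrow> i < n \<Longrightarrow> f x i \<in> {0..1}"
  shows "\<exists>x\<in>Q. \<forall>i<n. f x i = x i"
proof -
  define pt where "pt p v = (\<lambda>i. if i < n then real (v i) / real (Suc p) else 0)" for p and v :: "nat \<Rightarrow> nat"
  have ptQ: "pt p v \<in> Q" if "\<forall>i<n. v i \<le> Suc p" for p v
  proof -
    have "real (v i) / real (Suc p) \<le> 1" if "i < n" for i
      using \<open>\<forall>i<n. v i \<le> Suc p\<close> that by (simp add: divide_le_eq del: of_nat_Suc)
    then show ?thesis by (auto simp: pt_def Q_def)
  qed
  \<comment> \<open>\<open>q\<close> is the lowest corner of a cell, \<open>r i\<close> a corner not moved down in direction \<open>i\<close>,
    and \<open>s i\<close> one not moved up in that direction.\<close>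
  define R where "R p q r s \<longleftrightarrow> (\<forall>i<n. q i \<le> Suc p) \<and> (\<forall>i<n.
       (\<forall>j<n. q j \<le> r i j \<and> r i j \<le> q j + 1) \<and> (\<forall>j<n. q j \<le> s i j \<and> s i j \<le> q j + 1) \<and>
       (\<forall>j<n. r i j \<le> Suc p) \<and> (\<forall>j<n. s i j \<le> Suc p) \<and>
       f (pt p (r i)) i \<ge> pt p (r i) i \<and> f (pt p (s i)) i \<le> pt p (s i) i)" for p q r s
  have ex: "\<exists>q r s. R p q r s" for p
  proof -
    \<comment> \<open>The test \<open>v i \<noteq> Suc p\<close> enforces label 1 on the far face, as Kuhn's lemma demands. The map cannot
      raise coordinate \<open>i\<close> there either, so label 1 still means "not moved up".\<close>
    define label where "label v i = (if v i \<noteq> Suc p \<and> pt p v i \<le> f (pt p v) i then 0 else 1::nat)" for v i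
    have l1: "\<forall>v. (\<forall>i<n. v i \<le> Suc p) \<longrightarrow> (\<forall>i<n. label v i = 0 \<or> label v i = 1)"
      by (simp add: label_def)
    have l2: "\<forall>v. (\<forall>i<n. v i \<le> Suc p) \<longrightarrow> (\<forall>i<n. v i = 0 \<longrightarrow> label v i = 0)"
    proof (intro allI impI)
      fix v i assume v: "\<forall>i<n. v i \<le> Suc p" and i: "i < n" and "v i = 0"
      then show "label v i = 0" using into[OF ptQ[OF v] i] by (simp add: label_def pt_def)
    qed
    have l3: "\<forall>v. (\<forall>i<n. v i \<le> Suc p) \<longrightarrow> (\<forall>i<n. v i = Suc p \<longrightarrow> label v i = 1)"
      by (simp add: label_def)
    obtain q where q: "\<forall>i<n. q i < Suc p"
      and rs: "\<forall>i<n. \<exists>r s. (\<forall>j<n. q j \<le> r j \<and> r j \<le> q j + 1) \<and>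
        (\<forall>j<n. q j \<le> s j \<and> s j \<le> q j + 1) \<and> label r i \<noteq> label s i"
      using kuhn_lemma[OF _ l1 l2 l3] by blast
    have "\<exists>r s. (\<forall>j<n. q j \<le> r j \<and> r j \<le> q j + 1) \<and> (\<forall>j<n. q j \<le> s j \<and> s j \<le> q j + 1) \<and>
       (\<forall>j<n. r j \<le> Suc p) \<and> (\<forall>j<n. s j \<le> Suc p) \<and>
       f (pt p r) i \<ge> pt p r i \<and> f (pt p s) i \<le> pt p s i" if i: "i < n" for i
    proof -
      obtain r s where r: "\<forall>j<n. q j \<le> r j \<and> r j \<le> q j + 1" and s: "\<forall>j<n. q j \<le> s j \<and> s j \<le> q j + 1"
        and "label r i = 0" "label s i = 1"
      proof -
        obtain r s where "(\<forall>j<n. q j \<le> r j \<and> r j \<le> q j + 1) \<and>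
          (\<forall>j<n. q j \<le> s j \<and> s j \<le> q j + 1) \<and> label r i \<noteq> label s i"
          using rs i by blast
        moreover then have "label r i = 0 \<and> label s i = 1 \<or> label r i = 1 \<and> label s i = 0"
          by (auto simp: label_def split: if_splits)
        ultimately show thesis using that by blast
      qed
      have r': "\<forall>j<n. r j \<le> Suc p" and s': "\<forall>j<n. s j \<le> Suc p"
        using r s q by (metis Suc_eq_plus1 Suc_leI add_le_cancel_right le_trans less_Suc_eq_le)+
      have "pt p r i \<le> f (pt p r) i"
        using \<open>label r i = 0\<close> by (simp add: label_def split: if_splits)
      moreover have "f (pt p s) i \<le> pt p s i"
      proof (cases "s i = Suc p")
        case True
        then have "pt p s i = 1" using i by (simp add: pt_def del: of_nat_Suc)
        then show ?thesis using into[OF ptQ[OF s'] i] by simp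
      next
        case False
        then show ?thesis using \<open>label s i = 1\<close> by (simp add: label_def split: if_splits)
      qed
      ultimately show ?thesis using r s r' s' by blast
    qed
    then obtain r s where "\<forall>i<n. (\<forall>j<n. q j \<le> r i j \<and> r i j \<le> q j + 1) \<and> (\<forall>j<n. q j \<le> s i j \<and> s i j \<le> q j + 1) \<and>
       (\<forall>j<n. r i j \<le> Suc p) \<and> (\<forall>j<n. s i j \<le> Suc p) \<and>
       f (pt p (r i)) i \<ge> pt p (r i) i \<and> f (pt p (s i)) i \<le> pt p (s i) i"
      by metis
    then have "R p q r s" using q by (simp add: R_def less_imp_le)
    then show ?thesis by blast
  qed
  then obtain q r s where R: "\<And>p. R p (q p) (r p) (s p)" by metis
  have qrs: "\<And>p. \<forall>i<n. q p i \<le> Suc p"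
     "\<And>p i j. i < n \<Longrightarrow> j < n \<Longrightarrow> q p j \<le> r p i j \<and> r p i j \<le> q p j + 1"
     "\<And>p i j. i < n \<Longrightarrow> j < n \<Longrightarrow> q p j \<le> s p i j \<and> s p i j \<le> q p j + 1"
     "\<And>p i. i < n \<Longrightarrow> \<forall>j<n. r p i j \<le> Suc p"
     "\<And>p i. i < n \<Longrightarrow> \<forall>j<n. s p i j \<le> Suc p"
     "\<And>p i. i < n \<Longrightarrow> f (pt p (r p i)) i \<ge> pt p (r p i) i"
     "\<And>p i. i < n \<Longrightarrow> f (pt p (s p i)) i \<le> pt p (s p i) i"
    using R unfolding R_def by blast+
  have "seq_compact Q"
    unfolding Q_def by (rule compact_imp_seq_compact[OF compact_unit_cube])
  moreover have "\<forall>p. pt p (q p) \<in> Q" using ptQ qrs(1) by blast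
  ultimately obtain x k where x: "x \<in> Q" and k: "strict_mono (k :: nat \<Rightarrow> nat)"
    and lim: "((\<lambda>p. pt p (q p)) \<circ> k) \<longlonglongrightarrow> x"
    by (rule seq_compactE)
  have coord: "(\<lambda>m. y m i) \<longlonglongrightarrow> x i" if "y \<longlonglongrightarrow> x" for y :: "nat \<Rightarrow> nat \<Rightarrow> real" and i
    using continuous_on_tendsto_compose[OF continuous_on_product_coordinates that] by simp
  have near: "(\<lambda>m. pt (k m) (v (k m))) \<longlonglongrightarrow> x"
    if v: "\<And>p j. j < n \<Longrightarrow> q p j \<le> v p j \<and> v p j \<le> q p j + 1" for v
  proof (rule tendsto_fun_componentwise)
    fix j
    have a: "(\<lambda>m. pt (k m) (q (k m)) j) \<longlonglongrightarrow> x j"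
      using coord[OF lim] by (simp add: o_def)
    have "norm (pt (k m) (v (k m)) j - pt (k m) (q (k m)) j) \<le> 1 / real (Suc (k m))" for m
    proof (cases "j < n")
      case True
      then have "\<bar>real (v (k m) j) - real (q (k m) j)\<bar> \<le> 1" using v[of j "k m"] by auto
      with True show ?thesis
        by (simp add: pt_def flip: diff_divide_distrib) (simp add: divide_right_mono)
    qed (simp add: pt_def)
    moreover have "(\<lambda>m. 1 / real (Suc (k m))) \<longlonglongrightarrow> 0"
      using LIMSEQ_subseq_LIMSEQ[OF LIMSEQ_Suc[OF lim_1_over_n] k] by (simp add: o_def)
    ultimately have "(\<lambda>m. pt (k m) (v (k m)) j - pt (k m) (q (k m)) j) \<longlonglongrightarrow> 0"
      by (rule Lim_null_comparison[OF always_eventually, OF allI])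
    from tendsto_add[OF this a] show "(\<lambda>m. pt (k m) (v (k m)) j) \<longlonglongrightarrow> x j" by simp
  qed
  have "f x i = x i" if i: "i < n" for i
  proof (rule antisym)
    have r: "(\<lambda>m. pt (k m) (r (k m) i)) \<longlonglongrightarrow> x" and s: "(\<lambda>m. pt (k m) (s (k m) i)) \<longlonglongrightarrow> x"
      using near[of "\<lambda>p. r p i"] near[of "\<lambda>p. s p i"] qrs(2,3) i by auto
    have "(\<lambda>m. f (pt (k m) (r (k m) i)) i) \<longlonglongrightarrow> f x i" "(\<lambda>m. f (pt (k m) (s (k m) i)) i) \<longlonglongrightarrow> f x i"
      by (auto intro!: continuous_on_tendsto_compose[OF cont[OF i]] r s x always_eventually ptQ qrs(4,5) i)
    then show "x i \<le> f x i" and "f x i \<le> x i"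
      using LIMSEQ_le[OF coord[OF r]] LIMSEQ_le[OF _ coord[OF s]] qrs(6,7) i by blast+
  qed
  with x show ?thesis by blast
qed

lemma std_simplex_subset_cube: "std_simplex n \<subseteq> {x. \<forall>i. x i \<in> {0..1}}"
proof
  fix l assume l: "l \<in> std_simplex n"
  have "l i \<le> 1" for i
  proof (cases "i \<in> {1..n}")
    case True
    have "l i \<le> (\<Sum>i=1..n. l i)" by (rule member_le_sum) (use True l in \<open>auto simp: std_simplex_def\<close>)
    then show ?thesis using l by (simp add: std_simplex_def)
  qed (use l in \<open>auto simp: std_simplex_def\<close>)
  with l show "l \<in> {x. \<forall>i. x i \<in> {0..1}}" by (auto simp: std_simplex_def)
qed

lemma compact_std_simplex: "compact (std_simplex n)"
proof -
  have c: "continuous_on UNIV (\<lambda>l :: nat \<Rightarrow> real. l i)" for i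
    by (rule continuous_on_product_coordinates)
  have "std_simplex n = (\<Inter>i. {l. 0 \<le> l i}) \<inter> (\<Inter>i\<in>-{1..n}. {l. l i = 0}) \<inter> {l. (\<Sum>i=1..n. l i) = 1}"
    by (auto simp: std_simplex_def)
  moreover have "closed \<dots>"
    by (intro closed_Int closed_INT ballI closed_Collect_le closed_Collect_eq continuous_on_sum
        continuous_on_const c)
  ultimately have "closed (std_simplex n)" by simp
  moreover have "std_simplex n \<subseteq> {x. \<forall>i. x i \<in> {0..1}}" by (rule std_simplex_subset_cube)
  ultimately show ?thesis using compact_unit_cube compact_Int_closed by (metis inf.absorb_iff2)
qed

text \<open>
  The simplex is a retract of the cube, so Brouwer's theorem carries over: a fixed point of \<open>f \<circ> \<rho>\<close>,
  where \<open>\<rho>\<close> is the retraction, lies in the simplex and is fixed by \<open>f\<close>.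
\<close>
lemma brouwer_std_simplex:
  assumes cont: "\<And>i. i \<in> {1..n} \<Longrightarrow> continuous_on (std_simplex n) (\<lambda>l. f l i)"
    and into: "\<And>l. l \<in> std_simplex n \<Longrightarrow> f l \<in> std_simplex n"
    and n: "1 \<le> n"
  shows "\<exists>l\<in>std_simplex n. f l = l"
proof -
  let ?Q = "{x :: nat \<Rightarrow> real. \<forall>i. x i \<in> {0..1}}"
  define \<sigma> where "\<sigma> t = (\<Sum>i=1..n. t i)" for t :: "nat \<Rightarrow> real"
  \<comment> \<open>A point with coordinate sum below 1 is raised equally in all coordinates, one with larger sum
    is scaled down.\<close>
  define \<rho> where "\<rho> t = (\<lambda>i. if i \<in> {1..n} then (t i + max 0 (1 - \<sigma> t) / real n) / max 1 (\<sigma> t) else 0)"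
    for t :: "nat \<Rightarrow> real"
  have \<rho>_in: "\<rho> t \<in> std_simplex n" if "t \<in> ?Q" for t
  proof -
    have "(\<Sum>i=1..n. \<rho> t i) = (\<Sum>i=1..n. (t i + max 0 (1 - \<sigma> t) / real n) / max 1 (\<sigma> t))"
      by (rule sum.cong) (auto simp: \<rho>_def)
    also have "\<dots> = (\<sigma> t + max 0 (1 - \<sigma> t)) / max 1 (\<sigma> t)"
      using n by (simp add: sum_divide_distrib[symmetric] sum.distrib \<sigma>_def)
    also have "\<dots> = 1" by (simp add: max_def)
    finally show ?thesis using that by (auto simp: std_simplex_def \<rho>_def max_def)
  qed
  have \<rho>_id: "\<rho> l = l" if "l \<in> std_simplex n" for l
    using that by (auto simp: std_simplex_def \<rho>_def \<sigma>_def fun_eq_iff)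
  note sub = std_simplex_subset_cube[of n]
  have c\<sigma>: "continuous_on ?Q \<sigma>" unfolding \<sigma>_def
    by (intro continuous_intros continuous_on_subset[OF continuous_on_product_coordinates]) auto
  have "continuous_on ?Q \<rho>"
  proof (rule continuous_on_coordinatewise_then_product)
    fix i
    have "continuous_on ?Q (\<lambda>t. (t i + max 0 (1 - \<sigma> t) / real n) / max 1 (\<sigma> t))"
      using n by (intro continuous_intros c\<sigma> continuous_on_subset[OF continuous_on_product_coordinates]) auto
    then show "continuous_on ?Q (\<lambda>t. \<rho> t i)" by (cases "i \<in> {1..n}") (auto simp: \<rho>_def)
  qed
  have cf: "continuous_on ?Q (\<lambda>t. f (\<rho> t) i)" for i
  proof (cases "i \<in> {1..n}")
    case True
    show ?thesis
      by (rule continuous_on_compose2[OF cont[OF True] \<open>continuous_on ?Q \<rho>\<close>]) (use \<rho>_in in auto)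
  next
    case False
    then have "\<forall>t\<in>?Q. f (\<rho> t) i = 0" using into[OF \<rho>_in] unfolding std_simplex_def by blast
    then show ?thesis by (metis (mono_tags, lifting) continuous_on_cong continuous_on_const)
  qed
  have "f (\<rho> t) i \<in> {0..1}" if "t \<in> ?Q" for t i
    using subsetD[OF sub into[OF \<rho>_in[OF that]]] by blast
  then obtain x where x: "x \<in> ?Q" "\<forall>i<Suc n. f (\<rho> x) i = x i"
    using brouwer_unit_cube[of "Suc n" "\<lambda>t. f (\<rho> t)"] cf by blast
  define l where "l = f (\<rho> x)"
  have l: "l \<in> std_simplex n" unfolding l_def using into \<rho>_in x(1) by blast
  have "\<forall>i\<in>{1..n}. l i = x i" using x(2) by (auto simp: l_def)
  then have "\<sigma> l = \<sigma> x" unfolding \<sigma>_def by (intro sum.cong) auto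
  with \<open>\<forall>i\<in>{1..n}. l i = x i\<close> have "\<rho> l = \<rho> x" by (auto simp: \<rho>_def fun_eq_iff)
  then show ?thesis using l l_def \<rho>_id by metis
qed

section \<open>Finite partitions of unity on normal spaces\<close>

text \<open>
  The induction removes one set of the cover at a time: a Urysohn function for \<open>U k\<close> is positive at all
  points that only \<open>U k\<close> covers, so the open set where it is positive can take over the role of \<open>U k\<close>.
  The auxiliary set \<open>G\<close> collects these open sets.
\<close>
lemma finite_open_cover_bumps:
  assumes "normal_space S" and "finite J" and "\<And>k. k \<in> J \<Longrightarrow> openin S (U k)"
    and "openin S G" and "topspace S \<subseteq> G \<union> (\<Union>k\<in>J. U k)"
  shows "\<exists>w. (\<forall>k\<in>J. continuous_map S euclideanreal (w k) \<and>
                 (\<forall>x\<in>topspace S. 0 \<le> w k x \<and> (x \<notin> U k \<longrightarrow> w k x = 0))) \<and>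
             (\<forall>x\<in>topspace S - G. \<exists>k\<in>J. 0 < w k x)"
  using assms(2-)
proof (induction J arbitrary: G rule: finite_induct)
  case empty
  then show ?case by auto
next
  case (insert k J)
  \<comment> \<open>The points that are covered by \<open>U k\<close> alone.\<close>
  define A where "A = topspace S - (G \<union> (\<Union>k\<in>J. U k))"
  have "closedin S A"
    unfolding A_def using insert.prems by (intro closedin_diff closedin_topspace openin_Un openin_clauses(3)) auto
  moreover have "closedin S (topspace S - U k)"
    using insert.prems by blast
  moreover have "disjnt (topspace S - U k) A"
    using insert.prems unfolding A_def disjnt_def by auto
  ultimately obtain h where h: "continuous_map S (top_of_set {0..1::real}) h"
    "h ` (topspace S - U k) \<subseteq> {0}" "h ` A \<subseteq> {1}"
    using Urysohn_lemma[OF assms(1), of "topspace S - U k" A 0 1] by auto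
  then have hc: "continuous_map S euclideanreal h" and h01: "\<And>x. x \<in> topspace S \<Longrightarrow> 0 \<le> h x"
    by (auto simp: continuous_map_in_subtopology)
  have "openin S {x \<in> topspace S. h x \<in> {0<..}}"
    by (rule openin_continuous_map_preimage[OF hc]) auto
  then have "openin S (G \<union> {x \<in> topspace S. h x \<in> {0<..}})"
    using insert.prems by blast
  moreover have "topspace S \<subseteq> (G \<union> {x \<in> topspace S. h x \<in> {0<..}}) \<union> (\<Union>k\<in>J. U k)"
    using h(3) unfolding A_def by fastforce
  ultimately obtain w where w: "\<forall>k\<in>J. continuous_map S euclideanreal (w k) \<and>
                 (\<forall>x\<in>topspace S. 0 \<le> w k x \<and> (x \<notin> U k \<longrightarrow> w k x = 0))"
      "\<forall>x\<in>topspace S - (G \<union> {x \<in> topspace S. h x \<in> {0<..}}). \<exists>k\<in>J. 0 < w k x"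
    using insert.IH[of "G \<union> {x \<in> topspace S. h x \<in> {0<..}}"] insert.prems by auto
  have "k \<notin> J" by (rule insert.hyps)
  show ?case
  proof (intro exI[of _ "w(k := h)"] conjI ballI)
    show "continuous_map S euclideanreal ((w(k := h)) j)" if "j \<in> insert k J" for j
      using that w(1) hc by auto
    show "0 \<le> (w(k := h)) j x" if "j \<in> insert k J" "x \<in> topspace S" for j x
      using that w(1) h01 by auto
    show "x \<notin> U j \<longrightarrow> (w(k := h)) j x = 0" if "j \<in> insert k J" "x \<in> topspace S" for j x
      using that w(1) h(2) by auto
    show "\<exists>j\<in>insert k J. 0 < (w(k := h)) j x" if "x \<in> topspace S - G" for x
      using that w(2) \<open>k \<notin> J\<close> by (cases "h x > 0") auto
  qed
qed

lemma finite_partition_of_unity: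
  assumes "normal_space S" and "finite J" and "\<And>k. k \<in> J \<Longrightarrow> openin S (U k)"
    and "topspace S \<subseteq> (\<Union>k\<in>J. U k)"
  shows "\<exists>w. (\<forall>k\<in>J. continuous_map S euclideanreal (w k) \<and>
                 (\<forall>x\<in>topspace S. 0 \<le> w k x \<and> (w k x \<noteq> 0 \<longrightarrow> x \<in> U k))) \<and>
             (\<forall>x\<in>topspace S. (\<Sum>k\<in>J. w k x) = 1)"
proof -
  obtain v where v: "\<And>k. k \<in> J \<Longrightarrow> continuous_map S euclideanreal (v k)"
     "\<And>k x. k \<in> J \<Longrightarrow> x \<in> topspace S \<Longrightarrow> 0 \<le> v k x \<and> (x \<notin> U k \<longrightarrow> v k x = 0)"
     "\<And>x. x \<in> topspace S \<Longrightarrow> \<exists>k\<in>J. 0 < v k x"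
  proof -
    have "\<exists>w. (\<forall>k\<in>J. continuous_map S euclideanreal (w k) \<and>
                 (\<forall>x\<in>topspace S. 0 \<le> w k x \<and> (x \<notin> U k \<longrightarrow> w k x = 0))) \<and>
             (\<forall>x\<in>topspace S - {}. \<exists>k\<in>J. 0 < w k x)"
      by (rule finite_open_cover_bumps) (use assms in auto)
    then show thesis by (elim exE) (rule that, auto)
  qed
  define \<sigma> where "\<sigma> x = (\<Sum>k\<in>J. v k x)" for x
  have pos: "\<sigma> x > 0" if x: "x \<in> topspace S" for x
  proof -
    obtain k where "k \<in> J" "0 < v k x" using v(3)[OF x] by blast
    then show ?thesis unfolding \<sigma>_def using v(2) x \<open>finite J\<close> by (intro sum_pos2[of J k]) auto
  qed
  have "continuous_map S euclideanreal \<sigma>"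
    unfolding \<sigma>_def using v(1) \<open>finite J\<close> by (intro continuous_map_sum) auto
  show ?thesis
  proof (intro exI[of _ "\<lambda>k x. v k x / \<sigma> x"] conjI ballI)
    show "continuous_map S euclideanreal (\<lambda>x. v k x / \<sigma> x)" if "k \<in> J" for k
      using v(1) that pos \<open>continuous_map S euclideanreal \<sigma>\<close> by (intro continuous_map_real_divide) force+
    show "(\<Sum>k\<in>J. v k x / \<sigma> x) = 1" if "x \<in> topspace S" for x
      using pos[OF that] by (simp add: sum_divide_distrib[symmetric]) (simp add: \<sigma>_def)
  qed (use v(2) pos in \<open>force simp: less_imp_le\<close>)+
qed

section \<open>Hausdorff locally convex spaces\<close>

lemma lcs_subspace: "hausdorff_locally_convex E \<Longrightarrow> subspace (topspace E)"
  by (simp add: hausdorff_locally_convex_def)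

lemma lcs_Hausdorff: "hausdorff_locally_convex E \<Longrightarrow> Hausdorff_space E"
  by (simp add: hausdorff_locally_convex_def)

text \<open>
  The following lemmas make the defining properties of a locally convex space usable with arbitrary
  continuous maps into the space, in the way continuity is used for type classes.
\<close>
lemma continuous_map_lcs_add:
  assumes "hausdorff_locally_convex E" "continuous_map S E f" "continuous_map S E g"
  shows "continuous_map S E (\<lambda>x. f x + g x)"
proof -
  have "continuous_map (prod_topology E E) E (\<lambda>(x, y). x + y)"
    using assms(1) by (simp add: hausdorff_locally_convex_def)
  then show ?thesis
    using continuous_map_compose[OF continuous_map_pairedI[OF assms(2,3)]] by (fastforce simp: o_def)
qed

lemma continuous_map_lcs_scaleR:
  assumes "hausdorff_locally_convex E" "continuous_map S euclideanreal c" "continuous_map S E f"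
  shows "continuous_map S E (\<lambda>x. c x *\<^sub>R f x)"
proof -
  have "continuous_map (prod_topology euclideanreal E) E (\<lambda>(c, x). c *\<^sub>R x)"
    using assms(1) by (simp add: hausdorff_locally_convex_def)
  then show ?thesis
    using continuous_map_compose[OF continuous_map_pairedI[OF assms(2,3)]] by (fastforce simp: o_def)
qed

lemma continuous_map_lcs_diff:
  assumes "hausdorff_locally_convex E" "continuous_map S E f" "continuous_map S E g"
  shows "continuous_map S E (\<lambda>x. f x - g x)"
  using continuous_map_lcs_add[OF assms(1,2) continuous_map_lcs_scaleR[OF assms(1) _ assms(3), of "\<lambda>_. -1"]]
  by simp

lemma continuous_map_lcs_sum:
  assumes "hausdorff_locally_convex E" and "finite J" and "\<And>k. k \<in> J \<Longrightarrow> continuous_map S E (f k)"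
  shows "continuous_map S E (\<lambda>x. \<Sum>k\<in>J. f k x)"
  using assms(2,3)
proof (induction J rule: finite_induct)
  case empty
  then show ?case using subspace_0[OF lcs_subspace[OF assms(1)]] by simp
next
  case (insert k J)
  then show ?case by (simp add: continuous_map_lcs_add[OF assms(1)])
qed

definition symmetric_convex_nbhd :: "'e::real_vector topology \<Rightarrow> 'e set \<Rightarrow> bool"
  where "symmetric_convex_nbhd E V \<longleftrightarrow> openin E V \<and> 0 \<in> V \<and> convex V \<and> (\<forall>x\<in>V. - x \<in> V)"

lemma symmetric_convex_nbhd_topspace:
  "hausdorff_locally_convex E \<Longrightarrow> symmetric_convex_nbhd E (topspace E)"
  using lcs_subspace[of E] by (simp add: symmetric_convex_nbhd_def subspace_0 subspace_neg subspace_imp_convex)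

lemma symmetric_convex_nbhd_Int:
  "symmetric_convex_nbhd E V \<Longrightarrow> symmetric_convex_nbhd E W \<Longrightarrow> symmetric_convex_nbhd E (V \<inter> W)"
  by (simp add: symmetric_convex_nbhd_def convex_Int openin_Int)

text \<open>
  Compactness arguments choose a neighbourhood at each of finitely many points; this gives the single
  neighbourhood that serves all of them.
\<close>
lemma finite_symmetric_convex_nbhds:
  assumes "hausdorff_locally_convex E" and "finite J" and "\<And>j. j \<in> J \<Longrightarrow> symmetric_convex_nbhd E (V j)"
  obtains W where "symmetric_convex_nbhd E W" and "\<And>j. j \<in> J \<Longrightarrow> W \<subseteq> V j"
proof -
  have "\<exists>W. symmetric_convex_nbhd E W \<and> (\<forall>j\<in>J. W \<subseteq> V j)"
    using assms(2,3)
  proof (induction J rule: finite_induct)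
    case empty
    then show ?case using symmetric_convex_nbhd_topspace[OF assms(1)] by blast
  next
    case (insert j J)
    then obtain W where "symmetric_convex_nbhd E W" "\<forall>j\<in>J. W \<subseteq> V j" by auto
    then show ?case using insert.prems by (intro exI[of _ "W \<inter> V j"]) (auto intro: symmetric_convex_nbhd_Int)
  qed
  then show thesis using that by blast
qed

lemma openin_lcs_translate:
  assumes "hausdorff_locally_convex E" "a \<in> topspace E" "openin E V"
  shows "openin E {y \<in> topspace E. y - a \<in> V}"
  using openin_continuous_map_preimage[OF continuous_map_lcs_diff[OF assms(1) continuous_map_id[unfolded id_def]] assms(3)]
  assms(2) by simp

text \<open>
  Addition is continuous at zero and the topology has a base of convex neighbourhoods there; cutting such a
  neighbourhood with its reflection makes it symmetric.
\<close>
lemma lcs_nbhd_halving: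
  assumes E: "hausdorff_locally_convex E" and U: "openin E U" "0 \<in> U"
  obtains V where "symmetric_convex_nbhd E V" and "\<And>x y. x \<in> V \<Longrightarrow> y \<in> V \<Longrightarrow> x + y \<in> U"
proof -
  have 0: "0 \<in> topspace E" using subspace_0[OF lcs_subspace[OF E]] .
  have "openin (prod_topology E E) {p \<in> topspace (prod_topology E E). (\<lambda>(x, y). x + y) p \<in> U}"
    using E U by (intro openin_continuous_map_preimage) (auto simp: hausdorff_locally_convex_def)
  then obtain G H where GH: "openin E G" "openin E H" "0 \<in> G" "0 \<in> H"
     "G \<times> H \<subseteq> {p \<in> topspace (prod_topology E E). (\<lambda>(x, y). x + y) p \<in> U}"
  proof -
    have "(0, 0) \<in> {p \<in> topspace (prod_topology E E). (\<lambda>(x, y). x + y) p \<in> U}" using 0 U(2) by simp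
    with \<open>openin (prod_topology E E) _\<close> show thesis
      unfolding openin_prod_topology_alt using that by blast
  qed
  then obtain V where V: "openin E V" "0 \<in> V" "convex V" "V \<subseteq> G \<inter> H"
    using E unfolding hausdorff_locally_convex_def by (meson IntI openin_Int)
  define W where "W = V \<inter> {x \<in> topspace E. - x \<in> V}"
  have "openin E {x \<in> topspace E. - x \<in> V}"
    using openin_continuous_map_preimage[OF continuous_map_lcs_diff[OF E _ continuous_map_id[unfolded id_def]] V(1), of "\<lambda>_. 0"] 0
    by simp
  moreover have "convex {x \<in> topspace E. - x \<in> V}"
  proof -
    have "{x \<in> topspace E. - x \<in> V} = uminus ` V"
      using openin_subset[OF V(1)] subspace_neg[OF lcs_subspace[OF E]] by force
    then show ?thesis using convex_negations V(3) by metis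
  qed
  ultimately have "symmetric_convex_nbhd E W"
    using V 0 openin_subset[OF V(1)] by (auto simp: W_def symmetric_convex_nbhd_def convex_Int)
  moreover have "x + y \<in> U" if "x \<in> W" "y \<in> W" for x y
  proof -
    have "(x, y) \<in> G \<times> H" using that V(4) by (auto simp: W_def)
    then show ?thesis using GH(5) by auto
  qed
  ultimately show thesis using that by blast
qed

text \<open>
  The same at an arbitrary point. The displacement \<open>x - a\<close> is kept as a sum of two elements of \<open>V\<close>
  because in all applications it arises from passing through an intermediate point.
\<close>
lemma lcs_nbhd_halving_at:
  assumes E: "hausdorff_locally_convex E" and U: "openin E U" "a \<in> U"
  obtains V where "symmetric_convex_nbhd E V"
    and "\<And>x u v. x - a = u + v \<Longrightarrow> u \<in> V \<Longrightarrow> v \<in> V \<Longrightarrow> x \<in> U"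
proof -
  have a: "a \<in> topspace E" using U openin_subset by blast
  have "openin E {y \<in> topspace E. y + a \<in> U}"
    using openin_lcs_translate[OF E subspace_neg[OF lcs_subspace[OF E] a] U(1)] by simp
  moreover have "0 \<in> {y \<in> topspace E. y + a \<in> U}" using U subspace_0[OF lcs_subspace[OF E]] by simp
  ultimately
  obtain V where V: "symmetric_convex_nbhd E V"
     "\<And>x y. x \<in> V \<Longrightarrow> y \<in> V \<Longrightarrow> x + y \<in> {y \<in> topspace E. y + a \<in> U}"
    by (rule lcs_nbhd_halving[OF E]) blast
  show thesis
  proof (rule that[OF V(1)])
    fix x u v assume *: "x - a = u + v" "u \<in> V" "v \<in> V"
    then have "u + v + a \<in> U" using V(2) by blast
    then show "x \<in> U" using *(1) by (metis diff_add_cancel)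
  qed
qed

text \<open>
  If \<open>V + V\<close> is small enough for \<open>a + V + V\<close> to miss the closed set, then so does the closure of \<open>a + V\<close>.
  Regularity is needed to obtain normality of \<open>\<sigma>\<close>-compact subsets.
\<close>
lemma lcs_regular:
  assumes E: "hausdorff_locally_convex E"
  shows "regular_space E"
  unfolding regular_space
proof clarify
  fix C a assume C: "closedin E C" and a: "a \<in> topspace E" "a \<notin> C"
  obtain V where V: "symmetric_convex_nbhd E V"
    and sum: "\<And>x u v. x - a = u + v \<Longrightarrow> u \<in> V \<Longrightarrow> v \<in> V \<Longrightarrow> x \<in> topspace E - C"
    using lcs_nbhd_halving_at[OF E, of "topspace E - C" a] C a by blast
  let ?U = "{y \<in> topspace E. y - a \<in> V}"
  have "openin E ?U" using openin_lcs_translate[OF E a(1)] V by (simp add: symmetric_convex_nbhd_def)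
  moreover have "a \<in> ?U" using a V by (simp add: symmetric_convex_nbhd_def)
  moreover have "disjnt C (E closure_of ?U)"
  proof -
    have False if y: "y \<in> C" "y \<in> E closure_of ?U" for y
    proof -
      have yE: "y \<in> topspace E" using y C closedin_subset by blast
      define N where "N = {z \<in> topspace E. z - y \<in> V}"
      have "openin E N" "y \<in> N"
        using openin_lcs_translate[OF E yE] V yE unfolding symmetric_convex_nbhd_def N_def by auto
      then have "\<exists>z. z \<in> ?U \<and> z \<in> N" using y(2) unfolding in_closure_of by blast
      then obtain z where z: "z \<in> ?U" "z - y \<in> V" unfolding N_def by blast
      then have "- (z - y) \<in> V" "z - a \<in> V" using V unfolding symmetric_convex_nbhd_def by blast+
      moreover have "y - a = - (z - y) + (z - a)" by simp
      ultimately have "y \<in> topspace E - C" using sum by blast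
      then show False using y(1) by blast
    qed
    then show ?thesis by (auto simp: disjnt_def)
  qed
  ultimately show "\<exists>U. openin E U \<and> a \<in> U \<and> disjnt C (E closure_of U)" by blast
qed

text \<open>
  This allows the whole product of the action spaces to be treated as one locally convex space, so that the
  fixed point theorem has to be proved for a single space only.
\<close>
lemma hausdorff_locally_convex_product:
  fixes E :: "'i \<Rightarrow> 'e::real_vector topology"
  assumes E: "\<And>i. hausdorff_locally_convex (E i)"
  shows "hausdorff_locally_convex (product_topology E UNIV)"
proof -
  let ?L = "product_topology E UNIV"
  have proj: "continuous_map ?L (E i) (\<lambda>x. x i)" for i
    by (rule continuous_map_product_projection) simp
  have "subspace (topspace ?L)"
    using lcs_subspace[OF E] by (auto simp: subspace_def PiE_iff scaleR_fun_def plus_fun_def zero_fun_def)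
  moreover have "continuous_map (prod_topology ?L ?L) ?L (\<lambda>(x, y). x + y)"
    unfolding continuous_map_componentwise_UNIV case_prod_beta plus_fun_def
    by (intro allI continuous_map_lcs_add[OF E] continuous_map_compose[OF continuous_map_fst proj, unfolded o_def]
        continuous_map_compose[OF continuous_map_snd proj, unfolded o_def])
  moreover have "continuous_map (prod_topology euclideanreal ?L) ?L (\<lambda>(c, x). c *\<^sub>R x)"
    unfolding continuous_map_componentwise_UNIV case_prod_beta scaleR_fun_def
    by (intro allI continuous_map_lcs_scaleR[OF E] continuous_map_fst
        continuous_map_compose[OF continuous_map_snd proj, unfolded o_def])
  moreover have "Hausdorff_space ?L"
    using lcs_Hausdorff[OF E] by (simp add: Hausdorff_space_product_topology)
  moreover have "\<exists>V. openin ?L V \<and> 0 \<in> V \<and> convex V \<and> V \<subseteq> U" if U: "openin ?L U" "0 \<in> U" for U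
  proof -
    obtain G where G: "0 \<in> Pi\<^sub>E UNIV G" "\<forall>i. openin (E i) (G i)" "finite {i. G i \<noteq> topspace (E i)}" "Pi\<^sub>E UNIV G \<subseteq> U"
      using product_topology_open_contains_basis[OF U] by blast
    \<comment> \<open>The factors of \<open>V\<close> must remain the whole space wherever those of \<open>G\<close> are, or else their product
      would not be open.\<close>
    have "\<exists>V. openin (E i) V \<and> 0 \<in> V \<and> convex V \<and> V \<subseteq> G i \<and> (G i = topspace (E i) \<longrightarrow> V = topspace (E i))" for i
    proof (cases "G i = topspace (E i)")
      case True
      then show ?thesis using lcs_subspace[OF E, of i] by (auto simp: subspace_0 subspace_imp_convex)
    next
      case False
      have "0 \<in> G i" using G(1) by (auto simp: PiE_iff zero_fun_def)
      then show ?thesis using False E[of i] G(2) unfolding hausdorff_locally_convex_def by metis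
    qed
    then obtain V where V: "\<And>i. openin (E i) (V i) \<and> 0 \<in> V i \<and> convex (V i) \<and> V i \<subseteq> G i \<and>
       (G i = topspace (E i) \<longrightarrow> V i = topspace (E i))" by metis
    have "openin ?L (Pi\<^sub>E UNIV V)"
    proof (rule product_topology_basis)
      show "openin (E i) (V i)" for i using V by blast
      have "{i. V i \<noteq> topspace (E i)} \<subseteq> {i. G i \<noteq> topspace (E i)}" using V by blast
      then show "finite {i. V i \<noteq> topspace (E i)}" using G(3) by (rule finite_subset)
    qed
    moreover have "convex (Pi\<^sub>E UNIV V)"
    proof (rule convexI)
      fix x y :: "'i \<Rightarrow> 'e" and u v :: real
      assume "x \<in> Pi\<^sub>E UNIV V" "y \<in> Pi\<^sub>E UNIV V" "0 \<le> u" "0 \<le> v" "u + v = 1"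
      moreover have "convex (V i)" for i using V by blast
      ultimately show "u *\<^sub>R x + v *\<^sub>R y \<in> Pi\<^sub>E UNIV V"
        by (auto simp: PiE_iff plus_fun_def scaleR_fun_def intro: convexD)
    qed
    moreover have "0 \<in> V i" for i using V by blast
    then have "0 \<in> Pi\<^sub>E UNIV V" by (simp add: zero_fun_def PiE_iff)
    moreover have "Pi\<^sub>E UNIV V \<subseteq> Pi\<^sub>E UNIV G" by (rule PiE_mono) (use V in blast)
    then have "Pi\<^sub>E UNIV V \<subseteq> U" using G(4) by blast
    ultimately show ?thesis by blast
  qed
  ultimately show ?thesis unfolding hausdorff_locally_convex_def by blast
qed

section \<open>Fixed points of compact maps\<close>

lemma convex_sum_supported:
  assumes "finite J" and "convex V" and "(\<Sum>k\<in>J. w k) = 1" and "\<And>k. k \<in> J \<Longrightarrow> 0 \<le> w k"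
    and "\<And>k. k \<in> J \<Longrightarrow> w k \<noteq> 0 \<Longrightarrow> a k \<in> V"
  shows "(\<Sum>k\<in>J. w k *\<^sub>R a k) \<in> V"
proof -
  let ?J = "{k\<in>J. w k \<noteq> 0}"
  have "(\<Sum>k\<in>?J. w k) = (\<Sum>k\<in>J. w k)" "(\<Sum>k\<in>?J. w k *\<^sub>R a k) = (\<Sum>k\<in>J. w k *\<^sub>R a k)"
    using assms(1) by (intro sum.mono_neutral_left; auto)+
  moreover have "(\<Sum>k\<in>?J. w k *\<^sub>R a k) \<in> V"
    using assms calculation(1) by (intro convex_sum) auto
  ultimately show ?thesis by simp
qed

lemma compactin_finite_subcover_indexed:
  assumes "compactin S D" and "\<And>d. d \<in> D \<Longrightarrow> openin S (U d) \<and> d \<in> U d"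
  obtains J where "finite J" and "J \<subseteq> D" and "D \<subseteq> (\<Union>d\<in>J. U d)"
proof -
  have "\<exists>\<F>. finite \<F> \<and> \<F> \<subseteq> U ` D \<and> D \<subseteq> \<Union>\<F>"
    by (rule compactinD[OF assms(1)]) (use assms(2) in \<open>blast+\<close>)
  then obtain \<F> where "finite \<F>" "\<F> \<subseteq> U ` D" "D \<subseteq> \<Union>\<F>" by blast
  then obtain J where "J \<subseteq> D" "finite J" "\<F> = U ` J" by (meson finite_subset_image)
  with \<open>D \<subseteq> \<Union>\<F>\<close> show thesis by (intro that) auto
qed

text \<open>
  Schauder's projection. Finitely many translates \<open>d k + V\<close> cover \<open>D\<close>; a subordinate partition of
  unity \<open>w\<close> sends \<open>y \<in> D\<close> to the average \<open>\<Sum>k. w k y *\<^sub>R d k\<close>, which differs from \<open>y\<close> by an element of the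
  convex set \<open>V\<close>. Expressed through the weights, \<open>f\<close> followed by this projection is a continuous
  self-map of a standard simplex, and Brouwer's theorem gives a point \<open>x\<close> that is the projection of \<open>f x\<close>.
\<close>
lemma approximate_fixed_point:
  fixes E :: "'e::real_vector topology"
  assumes E: "hausdorff_locally_convex E" and C: "convex C" "C \<subseteq> topspace E" "C \<noteq> {}"
    and D: "compactin E D" "D \<subseteq> C"
    and f: "continuous_map (subtopology E C) E f" "f ` C \<subseteq> D"
    and V: "symmetric_convex_nbhd E V"
  shows "\<exists>x\<in>C. f x - x \<in> V"
proof -
  have V': "openin E V" "0 \<in> V" "convex V" using V by (auto simp: symmetric_convex_nbhd_def)
  have DE: "D \<subseteq> topspace E" using C D by blast
  define U where "U d = {y \<in> topspace E. y - d \<in> V}" for d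
  have U: "openin E (U d)" "d \<in> U d" if "d \<in> D" for d
    unfolding U_def using openin_lcs_translate[OF E] that DE V' by auto
  obtain J where J: "finite J" "J \<subseteq> D" "D \<subseteq> (\<Union>d\<in>J. U d)"
    using compactin_finite_subcover_indexed[OF D(1), of U] U by blast
  have "J \<noteq> {}" using C(3) f(2) J(3) by auto
  obtain d where d: "bij_betw d {1..card J} J" using ex_bij_betw_nat_finite_1[OF J(1)] by blast
  define n where "n = card J"
  have n: "1 \<le> n" using \<open>J \<noteq> {}\<close> J(1) by (simp add: n_def Suc_le_eq card_gt_0_iff)
  have dJ: "d ` {1..n} = J" using d by (simp add: bij_betw_def n_def)
  have dD: "d k \<in> D" if "k \<in> {1..n}" for k using dJ J(2) that by blast
  let ?S = "subtopology E D"
  have topS: "topspace ?S = D" using DE by auto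
  have "normal_space ?S"
    using D(1) lcs_Hausdorff[OF E] by (intro compact_Hausdorff_or_regular_imp_normal_space)
      (auto simp: compact_space_subtopology Hausdorff_space_subtopology)
  moreover have "openin ?S (D \<inter> U (d k))" if "k \<in> {1..n}" for k
    using U(1)[OF dD[OF that]] by (simp add: openin_subtopology_Int2)
  moreover have "topspace ?S \<subseteq> (\<Union>k\<in>{1..n}. D \<inter> U (d k))"
  proof -
    have "D \<subseteq> (\<Union>k\<in>{1..n}. U (d k))" using J(3) unfolding dJ[symmetric] by blast
    then show ?thesis unfolding topS by blast
  qed
  ultimately have "\<exists>w. (\<forall>k\<in>{1..n}. continuous_map ?S euclideanreal (w k) \<and>
       (\<forall>x\<in>topspace ?S. 0 \<le> w k x \<and> (w k x \<noteq> 0 \<longrightarrow> x \<in> D \<inter> U (d k)))) \<and>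
     (\<forall>x\<in>topspace ?S. (\<Sum>k=1..n. w k x) = 1)"
    by (intro finite_partition_of_unity) auto
  then obtain w where w: "\<And>k. k \<in> {1..n} \<Longrightarrow> continuous_map ?S euclideanreal (w k)"
    "\<And>k x. k \<in> {1..n} \<Longrightarrow> x \<in> topspace ?S \<Longrightarrow> 0 \<le> w k x"
    "\<And>k x. k \<in> {1..n} \<Longrightarrow> x \<in> topspace ?S \<Longrightarrow> w k x \<noteq> 0 \<Longrightarrow> x \<in> D \<inter> U (d k)"
    "\<And>x. x \<in> topspace ?S \<Longrightarrow> (\<Sum>k\<in>{1..n}. w k x) = 1"
    by blast
  define pt where "pt l = (\<Sum>k=1..n. l k *\<^sub>R d k)" for l
  have ptC: "pt l \<in> C" if "l \<in> std_simplex n" for l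
    unfolding pt_def using that dD D(2) by (intro convex_sum C(1)) (auto simp: std_simplex_def)
  have "continuous_map (top_of_set (std_simplex n)) E pt"
    unfolding pt_def
  proof (intro continuous_map_lcs_sum[OF E] continuous_map_lcs_scaleR[OF E])
    fix k assume "k \<in> {1..n}"
    then show "continuous_map (top_of_set (std_simplex n)) E (\<lambda>l. d k)"
      using dD DE by (simp add: subset_iff)
    show "continuous_map (top_of_set (std_simplex n)) euclideanreal (\<lambda>l. l k)"
      by (simp add: continuous_on_subset[OF continuous_on_product_coordinates])
  qed simp
  then have "continuous_map (top_of_set (std_simplex n)) (subtopology E C) pt"
    using ptC by (auto simp: continuous_map_in_subtopology)
  moreover have "continuous_map (subtopology E C) ?S f"
    using f by (auto simp: continuous_map_in_subtopology)
  ultimately have fpt: "continuous_map (top_of_set (std_simplex n)) ?S (\<lambda>l. f (pt l))"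
    using continuous_map_compose by (fastforce simp: o_def)
  have fD: "f (pt l) \<in> topspace ?S" if "l \<in> std_simplex n" for l using ptC[OF that] f(2) topS by blast
  \<comment> \<open>The weights of the projection of \<open>f (pt l)\<close>.\<close>
  define \<phi> where "\<phi> l = (\<lambda>k. if k \<in> {1..n} then w k (f (pt l)) else 0)" for l
  have "\<exists>l\<in>std_simplex n. \<phi> l = l"
  proof (rule brouwer_std_simplex[OF _ _ n])
    fix k assume k: "k \<in> {1..n}"
    have "continuous_map (top_of_set (std_simplex n)) euclideanreal (\<lambda>l. w k (f (pt l)))"
      using continuous_map_compose[OF fpt w(1)[OF k]] by (simp add: o_def)
    then show "continuous_on (std_simplex n) (\<lambda>l. \<phi> l k)" using k by (simp add: \<phi>_def)
  next
    fix l assume l: "l \<in> std_simplex n"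
    show "\<phi> l \<in> std_simplex n"
      using w(2,4) fD[OF l] by (auto simp: std_simplex_def \<phi>_def)
  qed
  then obtain l where l: "l \<in> std_simplex n" "\<phi> l = l" by blast
  define x where "x = pt l"
  have y: "f x \<in> topspace ?S" unfolding x_def by (rule fD[OF l(1)])
  have "l k = w k (f x)" if "k \<in> {1..n}" for k
    using fun_cong[OF l(2), of k] that by (simp add: \<phi>_def x_def)
  then have "x = (\<Sum>k=1..n. w k (f x) *\<^sub>R d k)" by (subst x_def) (simp add: pt_def)
  moreover have "f x = (\<Sum>k=1..n. w k (f x) *\<^sub>R f x)" using w(4)[OF y] by (simp flip: scaleR_left.sum)
  ultimately have "f x - x = (\<Sum>k=1..n. w k (f x) *\<^sub>R (f x - d k))"
    by (simp add: scaleR_diff_right sum_subtractf)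
  also have "\<dots> \<in> V"
    using w(2,3,4) y by (intro convex_sum_supported V'(3)) (auto simp: U_def)
  finally show ?thesis using ptC[OF l(1)] x_def by blast
qed

text \<open>
  The Schauder-Tychonoff theorem for compact maps. If no
  point of \<open>D\<close> is fixed, then near every \<open>y \<in> D\<close> the map displaces by more than some neighbourhood \<open>V y\<close>
  the points whose value is close to \<open>y\<close>. As all values lie in the compact set \<open>D\<close>, finitely many \<open>y\<close>
  suffice, which contradicts the existence of approximate fixed points.
\<close>
theorem lcs_compact_map_fixed_point:
  fixes E :: "'e::real_vector topology"
  assumes E: "hausdorff_locally_convex E" and C: "convex C" "C \<subseteq> topspace E" "C \<noteq> {}"
    and D: "compactin E D" "D \<subseteq> C"
    and f: "continuous_map (subtopology E C) E f" "f ` C \<subseteq> D"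
  shows "\<exists>x\<in>D. f x = x"
proof (rule ccontr)
  assume nofix: "\<not> ?thesis"
  have "\<exists>V. symmetric_convex_nbhd E V \<and> (\<forall>x\<in>C. f x - y \<in> V \<longrightarrow> f x - x \<notin> V)" if y: "y \<in> D" for y
  proof -
    have "y \<in> topspace E" "f y \<in> topspace E" "y \<in> C" "f y \<noteq> y"
      using y D(2) C(2) f(2) nofix by blast+
    then obtain A B where AB: "openin E A" "openin E B" "y \<in> A" "f y \<in> B" "disjnt A B"
      using lcs_Hausdorff[OF E] unfolding Hausdorff_space_def by metis
    have "openin (subtopology E C) {x \<in> topspace (subtopology E C). f x \<in> B}"
      by (rule openin_continuous_map_preimage[OF f(1) AB(2)])
    then obtain G where G: "openin E G" "{x \<in> topspace (subtopology E C). f x \<in> B} = G \<inter> C"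
      by (auto simp: openin_subtopology)
    have "y \<in> {x \<in> topspace (subtopology E C). f x \<in> B}" using \<open>y \<in> C\<close> \<open>y \<in> topspace E\<close> AB by simp
    then have "y \<in> A \<inter> G" using AB G(2) by blast
    then obtain V where V: "symmetric_convex_nbhd E V"
      "\<And>x u v. x - y = u + v \<Longrightarrow> u \<in> V \<Longrightarrow> v \<in> V \<Longrightarrow> x \<in> A \<inter> G"
      using lcs_nbhd_halving_at[OF E openin_Int[OF AB(1) G(1)]] by blast
    have False if x: "x \<in> C" "f x - y \<in> V" "f x - x \<in> V" for x
    proof -
      \<comment> \<open>Both \<open>f x\<close> and \<open>x\<close> are close to \<open>y\<close>; by continuity \<open>f x\<close> is then close to \<open>f y\<close> as well.\<close>
      have "- (f x - x) \<in> V" "0 \<in> V" using V(1) x(3) by (auto simp: symmetric_convex_nbhd_def)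
      then have "f x \<in> A" "x \<in> G"
        using V(2)[of "f x" "f x - y" 0] V(2)[of x "f x - y" "- (f x - x)"] x(2) by auto
      then show False using x(1) G(2) AB(5) by (auto simp: disjnt_def)
    qed
    then show ?thesis using V(1) by blast
  qed
  then obtain V where V: "\<And>y. y \<in> D \<Longrightarrow> symmetric_convex_nbhd E (V y)"
    "\<And>x y. y \<in> D \<Longrightarrow> x \<in> C \<Longrightarrow> f x - y \<in> V y \<Longrightarrow> f x - x \<notin> V y"
    by metis
  have DE: "D \<subseteq> topspace E" using C D by blast
  define U where "U y = {z \<in> topspace E. z - y \<in> V y}" for y
  have "openin E (U y) \<and> y \<in> U y" if "y \<in> D" for y
    unfolding U_def using openin_lcs_translate[OF E] that DE V(1)[OF that]
    by (auto simp: symmetric_convex_nbhd_def)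
  then obtain J where J: "finite J" "J \<subseteq> D" "D \<subseteq> (\<Union>y\<in>J. U y)"
    by (rule compactin_finite_subcover_indexed[OF D(1)])
  obtain W where W: "symmetric_convex_nbhd E W" "\<And>y. y \<in> J \<Longrightarrow> W \<subseteq> V y"
    using finite_symmetric_convex_nbhds[OF E J(1), of V] V(1) J(2) by blast
  obtain x where x: "x \<in> C" "f x - x \<in> W"
    using approximate_fixed_point[OF E C D f W(1)] by blast
  then obtain y where y: "y \<in> J" "f x \<in> U y" using f(2) J(3) by blast
  then have "f x - y \<in> V y" by (simp add: U_def)
  then show False using V(2)[of y x] y(1) J(2) x W(2)[OF y(1)] by blast
qed

section \<open>Continuous selections\<close>

text \<open>
  On a compact set the metric is uniformly controlled by differences of vectors. This is the Lebesgue number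
  argument, and the only link between the metric and the linear structure.
\<close>
lemma lcs_compact_metric_modulus:
  fixes E :: "'e::real_vector topology"
  assumes E: "hausdorff_locally_convex E" and D: "compactin E D"
    and met: "Metric_space D d" "subtopology E D = Metric_space.mtopology D d" and "0 < e"
  obtains V where "symmetric_convex_nbhd E V"
    and "\<And>x y. x \<in> D \<Longrightarrow> y \<in> D \<Longrightarrow> x - y \<in> V \<Longrightarrow> d x y < e"
proof -
  interpret Metric_space D d by (rule met(1))
  have DE: "D \<subseteq> topspace E" by (rule compactin_subset_topspace[OF D])
  have "\<exists>V. symmetric_convex_nbhd E V \<and>
          (\<forall>x u v. x \<in> D \<longrightarrow> x - a = u + v \<longrightarrow> u \<in> V \<longrightarrow> v \<in> V \<longrightarrow> d a x < e/2)" if a: "a \<in> D" for a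
  proof -
    have "openin (subtopology E D) (mball a (e/2))" using met(2) by simp
    then obtain G where G: "openin E G" "mball a (e/2) = G \<inter> D" unfolding openin_subtopology by blast
    have "a \<in> mball a (e/2)" using a \<open>0 < e\<close> by simp
    then have "a \<in> G" using G(2) by blast
    then obtain V where V: "symmetric_convex_nbhd E V"
      "\<And>x u v. x - a = u + v \<Longrightarrow> u \<in> V \<Longrightarrow> v \<in> V \<Longrightarrow> x \<in> G"
      using lcs_nbhd_halving_at[OF E G(1)] by blast
    have "d a x < e/2" if "x \<in> D" "x - a = u + v" "u \<in> V" "v \<in> V" for x u v
    proof -
      have "x \<in> mball a (e/2)" using V(2)[OF that(2-4)] that(1) G(2) by blast
      then show ?thesis by simp
    qed
    then show ?thesis using V(1) by blast
  qed
  then obtain V where V: "\<And>a. a \<in> D \<Longrightarrow> symmetric_convex_nbhd E (V a)"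
    "\<And>a x u v. a \<in> D \<Longrightarrow> x \<in> D \<Longrightarrow> x - a = u + v \<Longrightarrow> u \<in> V a \<Longrightarrow> v \<in> V a \<Longrightarrow> d a x < e/2"
    by metis
  have V0: "0 \<in> V a" "openin E (V a)" if "a \<in> D" for a
    using V(1)[OF that] by (auto simp: symmetric_convex_nbhd_def)
  define U where "U a = {z \<in> topspace E. z - a \<in> V a}" for a
  have "openin E (U a) \<and> a \<in> U a" if "a \<in> D" for a
    unfolding U_def using openin_lcs_translate[OF E] that DE V0[OF that] by auto
  then obtain J where J: "finite J" "J \<subseteq> D" "D \<subseteq> (\<Union>a\<in>J. U a)"
    by (rule compactin_finite_subcover_indexed[OF D])
  obtain W where W: "symmetric_convex_nbhd E W" "\<And>a. a \<in> J \<Longrightarrow> W \<subseteq> V a"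
    using finite_symmetric_convex_nbhds[OF E J(1), of V] V(1) J(2) by blast
  have "d x y < e" if xy: "x \<in> D" "y \<in> D" "x - y \<in> W" for x y
  proof -
    obtain a where a: "a \<in> J" "y \<in> U a" using J(3) xy(2) by blast
    then have aD: "a \<in> D" and ya: "y - a \<in> V a" using J(2) by (auto simp: U_def)
    have "d a y < e/2" using V(2)[OF aD xy(2) _ ya V0(1)[OF aD]] by simp
    moreover have "x - a = (x - y) + (y - a)" by simp
    then have "d a x < e/2" using V(2)[OF aD xy(1) _ _ ya] W(2)[OF a(1)] xy(3) by blast
    ultimately show ?thesis using triangle[OF xy(1) aD xy(2)] commute[of x a] by simp
  qed
  then show thesis using that W(1) by blast
qed

text \<open>
  The neighbourhoods that measure the accuracy of the successive approximate selections. Starting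
  with the whole space lets the construction begin with any map at all.
\<close>
lemma lcs_compact_metric_nbhd_sequence:
  fixes E :: "'e::real_vector topology"
  assumes E: "hausdorff_locally_convex E" and D: "compactin E D"
    and met: "Metric_space D d" "subtopology E D = Metric_space.mtopology D d"
  obtains V where "\<And>n. symmetric_convex_nbhd E (V n)" and "V 0 = topspace E"
    and "\<And>n x y. x \<in> V (Suc n) \<Longrightarrow> y \<in> V (Suc n) \<Longrightarrow> x + y \<in> V n"
    and "\<And>n x y. x \<in> D \<Longrightarrow> y \<in> D \<Longrightarrow> x - y \<in> V (Suc n) \<Longrightarrow> d x y < inverse (real (Suc n))"
proof -
  define P where "P n V \<longleftrightarrow> symmetric_convex_nbhd E V \<and> (n = 0 \<longrightarrow> V = topspace E)" for n :: nat and V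
  define Q where "Q n V W \<longleftrightarrow> (\<forall>x\<in>W. \<forall>y\<in>W. x + y \<in> V) \<and>
     (\<forall>x\<in>D. \<forall>y\<in>D. x - y \<in> W \<longrightarrow> d x y < inverse (real (Suc n)))" for n :: nat and V W
  have "\<exists>V. P 0 V" using symmetric_convex_nbhd_topspace[OF E] by (auto simp: P_def)
  moreover have "\<exists>W. P (Suc n) W \<and> Q n V W" if "P n V" for n V
  proof -
    have "openin E V" "0 \<in> V" using that by (auto simp: P_def symmetric_convex_nbhd_def)
    then obtain W where W: "symmetric_convex_nbhd E W" "\<And>x y. x \<in> W \<Longrightarrow> y \<in> W \<Longrightarrow> x + y \<in> V"
      using lcs_nbhd_halving[OF E] by blast
    obtain W' where W': "symmetric_convex_nbhd E W'"
      "\<And>x y. x \<in> D \<Longrightarrow> y \<in> D \<Longrightarrow> x - y \<in> W' \<Longrightarrow> d x y < inverse (real (Suc n))"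
      using lcs_compact_metric_modulus[OF E D met, of "inverse (real (Suc n))"] by auto
    have "P (Suc n) (W \<inter> W')" using symmetric_convex_nbhd_Int[OF W(1) W'(1)] by (simp add: P_def)
    moreover have "Q n V (W \<inter> W')" unfolding Q_def using W(2) W'(2) by blast
    ultimately show ?thesis by blast
  qed
  ultimately obtain V where V: "\<And>n. P n (V n)" "\<And>n. Q n (V n) (V (Suc n))"
    using dependent_nat_choice[of P Q] by blast
  show thesis
  proof (rule that[of V])
    show "symmetric_convex_nbhd E (V n)" for n using V(1) by (simp add: P_def)
    show "V 0 = topspace E" using V(1)[of 0] by (simp add: P_def)
  qed (use V(2) in \<open>unfold Q_def, blast+\<close>)
qed

text \<open>
  One step of Michael's construction. The points \<open>z \<in> F x\<close> that are \<open>V\<close>-close to \<open>f x\<close> still form a lower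
  semicontinuous convex-valued correspondence; covering \<open>D\<close> by finitely many translates of \<open>W\<close>
  produces a finite open cover of \<open>S\<close>, and a partition of unity subordinate to it averages the centres
  of these translates. Convexity of \<open>F x\<close>, \<open>V\<close> and \<open>W\<close> shows that the corresponding average of points of \<open>F x\<close> is
  close to both maps at once.
\<close>
lemma approximate_selection_refine:
  fixes E :: "'e::real_vector topology" and S :: "'s topology"
  assumes S: "normal_space S" and E: "hausdorff_locally_convex E" and D: "compactin E D"
    and F: "\<And>x. x \<in> topspace S \<Longrightarrow> F x \<subseteq> D" "\<And>x. x \<in> topspace S \<Longrightarrow> convex (F x)"
    and lsc: "lower_semicontinuous S E F"
    and f: "continuous_map S E f"
    and V: "symmetric_convex_nbhd E V" and W: "symmetric_convex_nbhd E W"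
    and near: "\<And>x. x \<in> topspace S \<Longrightarrow> \<exists>z\<in>F x. z - f x \<in> V"
  shows "\<exists>g. continuous_map S E g \<and> (\<forall>x\<in>topspace S. \<exists>z\<in>F x. z - f x \<in> V \<and> z - g x \<in> W)"
proof -
  have V': "openin E V" "convex V" and W': "openin E W" "0 \<in> W" "convex W"
    using V W by (auto simp: symmetric_convex_nbhd_def)
  have DE: "D \<subseteq> topspace E" by (rule compactin_subset_topspace[OF D])
  define U where "U a = {z \<in> topspace E. z - a \<in> W}" for a
  have U: "openin E (U a) \<and> a \<in> U a" if "a \<in> D" for a
    unfolding U_def using openin_lcs_translate[OF E] that DE W' by auto
  then obtain J where J: "finite J" "J \<subseteq> D" "D \<subseteq> (\<Union>a\<in>J. U a)"
    by (rule compactin_finite_subcover_indexed[OF D])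
  define G where "G a = {x \<in> topspace S. \<exists>z\<in>F x. z - f x \<in> V \<and> z \<in> U a}" for a
  have "openin S (G a)" if a: "a \<in> J" for a
  proof (subst openin_subopen, intro ballI)
    fix x assume "x \<in> G a"
    then obtain z where x: "x \<in> topspace S" and z: "z \<in> F x" "z - f x \<in> V" "z \<in> U a"
      unfolding G_def by blast
    have zE: "z \<in> topspace E" using F(1)[OF x] z(1) DE by blast
    let ?PS = "prod_topology E S"
    have "continuous_map ?PS E (\<lambda>p. fst p - f (snd p))"
      by (intro continuous_map_lcs_diff[OF E] continuous_map_fst
          continuous_map_compose[OF continuous_map_snd f, unfolded o_def])
    from openin_continuous_map_preimage[OF this V'(1)]
    have "openin ?PS {p \<in> topspace ?PS. fst p - f (snd p) \<in> V}" .
    moreover have "(z, x) \<in> {p \<in> topspace ?PS. fst p - f (snd p) \<in> V}" using x zE z(2) by simp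
    ultimately obtain A B where AB: "openin E A" "openin S B" "z \<in> A" "x \<in> B"
      "A \<times> B \<subseteq> {p \<in> topspace ?PS. fst p - f (snd p) \<in> V}"
      unfolding openin_prod_topology_alt by meson
    have "openin E (A \<inter> U a)" using AB(1) U a J(2) by blast
    moreover have "F x \<inter> (A \<inter> U a) \<noteq> {}" using z AB(3) by blast
    ultimately obtain N where N: "openin S N" "x \<in> N" "\<forall>y\<in>N. F y \<inter> (A \<inter> U a) \<noteq> {}"
      using lsc x unfolding lower_semicontinuous_def by meson
    have "y \<in> G a" if y: "y \<in> N \<inter> B" for y
    proof -
      obtain v where v: "v \<in> F y" "v \<in> A" "v \<in> U a" using N(3) y by blast
      have "(v, y) \<in> A \<times> B" using v(2) y by blast
      then have "v - f y \<in> V" using AB(5) by auto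
      then show ?thesis using v(1,3) y N(1) openin_subset unfolding G_def by blast
    qed
    then show "\<exists>T. openin S T \<and> x \<in> T \<and> T \<subseteq> G a"
      using N(1,2) AB(2,4) by (intro exI[of _ "N \<inter> B"]) auto
  qed
  moreover have "topspace S \<subseteq> (\<Union>a\<in>J. G a)"
  proof
    fix x assume x: "x \<in> topspace S"
    then obtain z where z: "z \<in> F x" "z - f x \<in> V" using near by blast
    then obtain a where "a \<in> J" "z \<in> U a" using F(1)[OF x] J(3) by blast
    then show "x \<in> (\<Union>a\<in>J. G a)" using x z unfolding G_def by blast
  qed
  ultimately have "\<exists>w. (\<forall>a\<in>J. continuous_map S euclideanreal (w a) \<and>
       (\<forall>x\<in>topspace S. 0 \<le> w a x \<and> (w a x \<noteq> 0 \<longrightarrow> x \<in> G a))) \<and>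
     (\<forall>x\<in>topspace S. (\<Sum>a\<in>J. w a x) = 1)"
    by (intro finite_partition_of_unity S J(1))
  then obtain w where w: "\<And>a. a \<in> J \<Longrightarrow> continuous_map S euclideanreal (w a)"
    "\<And>a x. a \<in> J \<Longrightarrow> x \<in> topspace S \<Longrightarrow> 0 \<le> w a x"
    "\<And>a x. a \<in> J \<Longrightarrow> x \<in> topspace S \<Longrightarrow> w a x \<noteq> 0 \<Longrightarrow> x \<in> G a"
    "\<And>x. x \<in> topspace S \<Longrightarrow> (\<Sum>a\<in>J. w a x) = 1"
    by blast
  define g where "g x = (\<Sum>a\<in>J. w a x *\<^sub>R a)" for x
  have "continuous_map S E g"
    unfolding g_def
  proof (intro continuous_map_lcs_sum[OF E J(1)] continuous_map_lcs_scaleR[OF E] w(1))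
    show "continuous_map S E (\<lambda>x. a)" if "a \<in> J" for a using that J(2) DE by (simp add: subset_iff)
  qed
  moreover have "\<exists>z\<in>F x. z - f x \<in> V \<and> z - g x \<in> W" if x: "x \<in> topspace S" for x
  proof -
    have "\<forall>a\<in>J. \<exists>z. w a x \<noteq> 0 \<longrightarrow> z \<in> F x \<and> z - f x \<in> V \<and> z - a \<in> W"
      using w(3)[OF _ x] unfolding G_def U_def by blast
    then obtain \<zeta> where \<zeta>: "\<And>a. a \<in> J \<Longrightarrow> w a x \<noteq> 0 \<Longrightarrow> \<zeta> a \<in> F x"
      "\<And>a. a \<in> J \<Longrightarrow> w a x \<noteq> 0 \<Longrightarrow> \<zeta> a - f x \<in> V"
      "\<And>a. a \<in> J \<Longrightarrow> w a x \<noteq> 0 \<Longrightarrow> \<zeta> a - a \<in> W"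
      by metis
    note comb = convex_sum_supported[OF J(1) _ w(4)[OF x] w(2)[OF _ x]]
    let ?z = "\<Sum>a\<in>J. w a x *\<^sub>R \<zeta> a"
    have "?z \<in> F x" by (rule comb[OF F(2)[OF x] _ \<zeta>(1)])
    moreover have "(\<Sum>a\<in>J. w a x *\<^sub>R (\<zeta> a - f x)) \<in> V" by (rule comb[OF V'(2) _ \<zeta>(2)])
    then have "?z - f x \<in> V"
      by (simp add: scaleR_diff_right sum_subtractf w(4)[OF x] flip: scaleR_left.sum)
    moreover have "(\<Sum>a\<in>J. w a x *\<^sub>R (\<zeta> a - a)) \<in> W" by (rule comb[OF W'(3) _ \<zeta>(3)])
    then have "?z - g x \<in> W" by (simp add: scaleR_diff_right sum_subtractf g_def)
    ultimately show ?thesis by blast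
  qed
  ultimately show ?thesis by blast
qed

text \<open>
  The approximate selections \<open>f n\<close> may leave \<open>D\<close>, and only on \<open>D\<close> do the neighbourhoods control a
  complete metric. The limit is therefore taken of nearby points \<open>z n x \<in> F x \<subseteq> D\<close>: they form a uniform
  Cauchy sequence for the metric of \<open>D\<close>, and although \<open>z n\<close> need not be continuous, it varies by
  little where the continuous map \<open>f n\<close> does, which is enough for the limit to be continuous.
\<close>
theorem michael_selection_compact_metrizable:
  fixes E :: "'e::real_vector topology" and S :: "'s topology"
  assumes S: "normal_space S" and E: "hausdorff_locally_convex E"
    and D: "compactin E D" "metrizable_space (subtopology E D)"
    and F: "\<And>x. x \<in> topspace S \<Longrightarrow> F x \<noteq> {}" "\<And>x. x \<in> topspace S \<Longrightarrow> F x \<subseteq> D"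
      "\<And>x. x \<in> topspace S \<Longrightarrow> convex (F x)" "\<And>x. x \<in> topspace S \<Longrightarrow> closedin E (F x)"
    and lsc: "lower_semicontinuous S E F"
  shows "\<exists>f. continuous_map S E f \<and> (\<forall>x\<in>topspace S. f x \<in> F x)"
proof -
  have DE: "D \<subseteq> topspace E" by (rule compactin_subset_topspace[OF D(1)])
  obtain M d where "Metric_space M d" and eq: "subtopology E D = Metric_space.mtopology M d"
    using D(2) unfolding metrizable_space_def by blast
  moreover have "M = D"
    using Metric_space.topspace_mtopology[OF \<open>Metric_space M d\<close>] eq DE
    by (metis topspace_subtopology_subset)
  ultimately have met: "Metric_space D d" "subtopology E D = Metric_space.mtopology D d" by simp_all
  interpret Metric_space D d by (rule met(1))
  obtain V where V: "\<And>n. symmetric_convex_nbhd E (V n)" "V 0 = topspace E"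
    "\<And>n x y. x \<in> V (Suc n) \<Longrightarrow> y \<in> V (Suc n) \<Longrightarrow> x + y \<in> V n"
    "\<And>n x y. x \<in> D \<Longrightarrow> y \<in> D \<Longrightarrow> x - y \<in> V (Suc n) \<Longrightarrow> d x y < inverse (real (Suc n))"
    by (rule lcs_compact_metric_nbhd_sequence[OF E D(1) met]) blast
  have V0: "0 \<in> V n" and Vneg: "v \<in> V n \<Longrightarrow> - v \<in> V n" and Vopen: "openin E (V n)" for n v
    using V(1)[of n] by (auto simp: symmetric_convex_nbhd_def)
  have Vmono: "v \<in> V n" if "v \<in> V (Suc n)" for v n using V(3)[OF that V0] by simp
  define P where "P n f \<longleftrightarrow> continuous_map S E f \<and> (\<forall>x\<in>topspace S. \<exists>z\<in>F x. z - f x \<in> V n)" for n f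
  define Q where "Q n f g \<longleftrightarrow> (\<forall>x\<in>topspace S. \<exists>z\<in>F x. z - f x \<in> V n \<and> z - g x \<in> V (Suc n))" for n f g
  have "P 0 (\<lambda>x. 0)"
    unfolding P_def V(2) using F(1,2) DE subspace_0[OF lcs_subspace[OF E]] by fastforce
  moreover have "\<exists>g. P (Suc n) g \<and> Q n f g" if "P n f" for n f
  proof -
    have "\<exists>g. continuous_map S E g \<and>
        (\<forall>x\<in>topspace S. \<exists>z\<in>F x. z - f x \<in> V n \<and> z - g x \<in> V (Suc n))"
      using that unfolding P_def by (intro approximate_selection_refine[OF S E D(1) F(2,3) lsc] V(1)) auto
    then show ?thesis unfolding P_def Q_def by blast
  qed
  ultimately obtain f where f: "\<And>n. P n (f n)" "\<And>n. Q n (f n) (f (Suc n))"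
    using dependent_nat_choice[of P Q] by blast
  have "\<forall>n x. \<exists>z. x \<in> topspace S \<longrightarrow> z \<in> F x \<and> z - f n x \<in> V n \<and> z - f (Suc n) x \<in> V (Suc n)"
    using f(2) unfolding Q_def by blast
  then obtain z where z: "\<And>n x. x \<in> topspace S \<Longrightarrow> z n x \<in> F x"
    "\<And>n x. x \<in> topspace S \<Longrightarrow> z n x - f n x \<in> V n"
    "\<And>n x. x \<in> topspace S \<Longrightarrow> z n x - f (Suc n) x \<in> V (Suc n)"
    by metis
  have zD: "z n x \<in> D" if "x \<in> topspace S" for n x using z(1)[OF that] F(2)[OF that] by blast
  have step: "z (Suc n) x - z n x \<in> V n" if "x \<in> topspace S" for n x
  proof -
    have "(z (Suc n) x - f (Suc n) x) + - (z n x - f (Suc n) x) \<in> V n"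
      using V(3) z(2)[OF that] Vneg[OF z(3)[OF that]] by blast
    then show ?thesis by simp
  qed
  \<comment> \<open>Since \<open>V (Suc n) + V (Suc n) \<subseteq> V n\<close>, all later increments together stay within one neighbourhood.\<close>
  have tail: "z (Suc n + k) x - z (Suc n) x \<in> V n" if "x \<in> topspace S" for n k x
  proof (induction k arbitrary: n)
    case 0
    then show ?case using V0 by simp
  next
    case (Suc k)
    have "(z (Suc (Suc n) + k) x - z (Suc (Suc n)) x) + (z (Suc (Suc n)) x - z (Suc n) x) \<in> V n"
      using V(3)[OF Suc.IH[of "Suc n"] step[OF that, of "Suc n"]] .
    then show ?case by simp
  qed
  have dist: "d (z (Suc (Suc m) + k) x) (z (Suc (Suc m)) x) < inverse (real (Suc m))"
    if "x \<in> topspace S" for m k x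
    by (rule V(4)[OF zD[OF that] zD[OF that] tail[OF that]])
  have "\<exists>l. limitin mtopology (\<lambda>n. z n x) l sequentially" if x: "x \<in> topspace S" for x
  proof -
    have "compact_space mtopology" using D(1) by (metis met(2) compact_space_subtopology)
    then have "mcomplete" by (rule compact_space_imp_mcomplete)
    moreover have "MCauchy (\<lambda>n. z n x)"
      unfolding MCauchy_def
    proof (intro conjI allI impI)
      show "range (\<lambda>n. z n x) \<subseteq> D" using zD[OF x] by blast
      fix e :: real assume "0 < e"
      then obtain m where m: "inverse (real (Suc m)) < e/2"
        using reals_Archimedean[of "e/2"] by auto
      have "d (z n x) (z n' x) < e" if "Suc (Suc m) \<le> n" "Suc (Suc m) \<le> n'" for n n'
      proof -
        obtain k k' where "n = Suc (Suc m) + k" "n' = Suc (Suc m) + k'"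
          using \<open>Suc (Suc m) \<le> n\<close> \<open>Suc (Suc m) \<le> n'\<close> by (auto dest!: le_Suc_ex)
        then have "d (z n x) (z (Suc (Suc m)) x) < e/2" "d (z n' x) (z (Suc (Suc m)) x) < e/2"
          using less_trans[OF dist[OF x, of m k] m] less_trans[OF dist[OF x, of m k'] m] by simp_all
        then show ?thesis
          using triangle[OF zD[OF x, of n] zD[OF x, of "Suc (Suc m)"] zD[OF x, of n']]
            commute[of "z n' x" "z (Suc (Suc m)) x"] by linarith
      qed
      then show "\<exists>N. \<forall>n n'. N \<le> n \<longrightarrow> N \<le> n' \<longrightarrow> d (z n x) (z n' x) < e" by blast
    qed
    ultimately show ?thesis unfolding mcomplete_def by blast
  qed
  then obtain g where g: "\<And>x. x \<in> topspace S \<Longrightarrow> limitin mtopology (\<lambda>n. z n x) (g x) sequentially"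
    by metis
  have gF: "g x \<in> F x" if x: "x \<in> topspace S" for x
  proof -
    have "closedin mtopology (F x)"
      using F(2,4)[OF x] by (metis closedin_subset_topspace met(2))
    then show ?thesis
      by (rule limitin_closedin[OF g[OF x]]) (use z(1)[OF x] in auto)
  qed
  have gD: "g x \<in> D" if "x \<in> topspace S" for x using gF[OF that] F(2)[OF that] by blast
  have close: "d (z (Suc (Suc m)) x) (g x) \<le> inverse (real (Suc m))" if x: "x \<in> topspace S" for m x
  proof (rule field_le_epsilon)
    fix e :: real assume "0 < e"
    then obtain N where "\<forall>n\<ge>N. d (z n x) (g x) < e"
      using g[OF x] unfolding limit_metric_sequentially by blast
    then have "d (z (Suc (Suc m) + N) x) (g x) < e" by simp
    then show "d (z (Suc (Suc m)) x) (g x) \<le> inverse (real (Suc m)) + e"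
      using triangle[OF zD[OF x, of "Suc (Suc m)"] zD[OF x, of "Suc (Suc m) + N"] gD[OF x]]
        dist[OF x, of m N] commute[of "z (Suc (Suc m)) x" "z (Suc (Suc m) + N) x"] by linarith
  qed
  have "continuous_map S mtopology g"
    unfolding continuous_map_to_metric
  proof (intro ballI allI impI)
    fix a and e :: real assume a: "a \<in> topspace S" and "0 < e"
    then obtain m where m: "inverse (real (Suc m)) < e/3"
      using reals_Archimedean[of "e/3"] by auto
    \<comment> \<open>\<open>z p x - z p a\<close> is a sum of three elements of \<open>V p\<close>, which costs two indices; the modulus of
      continuity costs the third.\<close>
    define p where "p = Suc (Suc (Suc m))"
    have fp: "continuous_map S E (f p)" using f(1) by (simp add: P_def)
    then have "continuous_map S E (\<lambda>x. f p x - f p a)"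
      using a by (intro continuous_map_lcs_diff[OF E]) (auto simp: continuous_map_def)
    then have "openin S {x \<in> topspace S. f p x - f p a \<in> V p}"
      by (rule openin_continuous_map_preimage[OF _ Vopen])
    moreover have "a \<in> {x \<in> topspace S. f p x - f p a \<in> V p}" using a V0 by simp
    moreover have "g x \<in> mball (g a) e" if "x \<in> {x \<in> topspace S. f p x - f p a \<in> V p}" for x
    proof -
      have x: "x \<in> topspace S" and fx: "f p x - f p a \<in> V p" using that by auto
      have 1: "(z p x - f p x) + (f p x - f p a) \<in> V (Suc (Suc m))"
        using V(3) z(2)[OF x] fx unfolding p_def by blast
      have "- (z p a - f p a) \<in> V (Suc (Suc m))"
        using Vmono Vneg[OF z(2)[OF a]] unfolding p_def by blast
      from V(3)[OF 1 this] have "z p x - z p a \<in> V (Suc m)" by simp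
      then have "d (z p x) (z p a) < inverse (real (Suc m))" by (rule V(4)[OF zD[OF x] zD[OF a]])
      moreover have "inverse (real (Suc (Suc m))) \<le> inverse (real (Suc m))" by simp
      then have "d (z p x) (g x) \<le> inverse (real (Suc m))" "d (z p a) (g a) \<le> inverse (real (Suc m))"
        using close[OF x, of "Suc m"] close[OF a, of "Suc m"] unfolding p_def by linarith+
      moreover have "d (g a) (g x) \<le> d (g a) (z p a) + (d (z p a) (z p x) + d (z p x) (g x))"
        using triangle[OF gD[OF a] zD[OF a, of p] gD[OF x]] triangle[OF zD[OF a, of p] zD[OF x, of p] gD[OF x]]
        by linarith
      ultimately have "d (g a) (g x) < e"
        using m commute[of "g a" "z p a"] commute[of "z p a" "z p x"] by linarith
      then show ?thesis using gD x a by simp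
    qed
    ultimately show "\<exists>U. openin S U \<and> a \<in> U \<and> (\<forall>y\<in>U. g y \<in> mball (g a) e)" by blast
  qed
  then have "continuous_map S (subtopology E D) g" using met(2) by simp
  then have "continuous_map S E g" by (rule continuous_map_into_fulltopology)
  then show ?thesis using gF by blast
qed

section \<open>Families of lower semicontinuous correspondences\<close>

text \<open>
  Adding all segments between points of a compact set gives a compact set again, and the
  union of the iterates is convex. It is the convex hull, obtained without convex combinations of
  unbounded length.
\<close>
lemma convex_sigma_compact_superset:
  fixes E :: "'e::real_vector topology"
  assumes E: "hausdorff_locally_convex E" and D: "compactin E D" "D \<subseteq> X" and X: "convex X"
  obtains C where "D \<subseteq> C" and "C \<subseteq> X" and "convex C" and "Lindelof_space (subtopology E C)"
proof -
  define seg where "seg = (\<lambda>(t::real, x::'e, y). (1 - t) *\<^sub>R x + t *\<^sub>R y)"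
  define A where "A n = ((\<lambda>B. seg ` ({0..1} \<times> B \<times> B)) ^^ n) D" for n :: nat
  have A0: "A 0 = D" and ASuc: "A (Suc n) = seg ` ({0..1} \<times> A n \<times> A n)" for n
    by (simp_all add: A_def)
  let ?P = "prod_topology euclideanreal (prod_topology E E)"
  have s: "continuous_map ?P E (\<lambda>p. fst (snd p))" "continuous_map ?P E (\<lambda>p. snd (snd p))"
    by (intro continuous_map_compose[OF continuous_map_snd continuous_map_fst, unfolded o_def]
        continuous_map_compose[OF continuous_map_snd continuous_map_snd, unfolded o_def])+
  have "continuous_map ?P E seg"
    unfolding seg_def case_prod_beta
    by (intro continuous_map_lcs_add[OF E] continuous_map_lcs_scaleR[OF E] s continuous_map_fst
        continuous_map_diff continuous_map_canonical_const)
  then have comp: "compactin E (A n)" for n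
    by (induction n) (auto simp: A0 ASuc D(1) compactin_Times intro!: image_compactin)
  have AX: "A n \<subseteq> X" for n
  proof (induction n)
    case (Suc n)
    show ?case
    proof
      fix z assume "z \<in> A (Suc n)"
      then obtain t x y where "t \<in> {0..1}" "x \<in> A n" "y \<in> A n" "z = seg (t, x, y)"
        unfolding ASuc by blast
      moreover then have "0 \<le> t \<and> t \<le> 1" "x \<in> X" "y \<in> X" using Suc by auto
      ultimately show "z \<in> X" using X unfolding convex_alt seg_def by simp
    qed
  qed (use A0 D(2) in simp)
  have mono: "A n \<subseteq> A (Suc n)" for n
  proof
    fix x assume "x \<in> A n"
    then have "seg (0, x, x) \<in> A (Suc n)" unfolding ASuc by auto
    then show "x \<in> A (Suc n)" by (simp add: seg_def)
  qed
  define C where "C = (\<Union>n. A n)"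
  show thesis
  proof (rule that[of C])
    show "D \<subseteq> C" unfolding C_def using A0 by blast
    show "C \<subseteq> X" unfolding C_def using AX by blast
    show "convex C"
      unfolding convex_alt
    proof (intro ballI allI impI)
      fix x y and t :: real assume "x \<in> C" "y \<in> C" and t: "0 \<le> t \<and> t \<le> 1"
      then obtain m n where "x \<in> A m" "y \<in> A n" unfolding C_def by blast
      moreover have "A m \<subseteq> A (max m n)" "A n \<subseteq> A (max m n)"
        by (rule lift_Suc_mono_le[of A, OF mono]; simp)+
      ultimately have "x \<in> A (max m n)" "y \<in> A (max m n)" by blast+
      then have "seg (t, x, y) \<in> A (Suc (max m n))" using t unfolding ASuc by auto
      then have "seg (t, x, y) \<in> C" unfolding C_def by blast
      then show "(1 - t) *\<^sub>R x + t *\<^sub>R y \<in> C" by (simp add: seg_def)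
    qed
    have "Lindelof_space (subtopology E (\<Union>(range A)))"
      by (rule Lindelof_space_Union) (auto simp: comp compact_space_subtopology intro!: compact_imp_Lindelof_space)
    then show "Lindelof_space (subtopology E C)" by (simp add: C_def)
  qed
qed

text \<open>
  The selections are taken on a \<open>\<sigma>\<close>-compact convex set \<open>C\<close> between \<open>\<Prod>i. D i\<close> and \<open>\<Prod>i. X i\<close>: it is normal, as
  Michael's theorem requires, and convex, as the fixed point theorem requires. In general neither
  \<open>\<Prod>i. D i\<close> nor \<open>\<Prod>i. X i\<close> has both properties: the first need not be convex, and the second need
  not be normal.
\<close>
theorem lsc_family_fixed_point:
  fixes E :: "'i \<Rightarrow> 'e::real_vector topology" and X D :: "'i \<Rightarrow> 'e set"
    and F :: "'i \<Rightarrow> ('i \<Rightarrow> 'e) \<Rightarrow> 'e set"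
  defines "S \<equiv> subtopology (product_topology E UNIV) (Pi\<^sub>E UNIV X)"
  assumes E: "\<And>i. hausdorff_locally_convex (E i)"
    and X: "\<And>i. X i \<subseteq> topspace (E i)" "\<And>i. convex (X i)"
    and D: "\<And>i. D i \<subseteq> X i" "\<And>i. D i \<noteq> {}" "\<And>i. compactin (E i) (D i)"
      "\<And>i. metrizable_space (subtopology (E i) (D i))"
    and F: "\<And>i x. x \<in> Pi\<^sub>E UNIV X \<Longrightarrow> F i x \<noteq> {}" "\<And>i x. x \<in> Pi\<^sub>E UNIV X \<Longrightarrow> F i x \<subseteq> D i"
      "\<And>i x. x \<in> Pi\<^sub>E UNIV X \<Longrightarrow> convex (F i x)" "\<And>i x. x \<in> Pi\<^sub>E UNIV X \<Longrightarrow> closedin (E i) (F i x)"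
    and lsc: "\<And>i. lower_semicontinuous S (E i) (F i)"
  shows "\<exists>x\<in>Pi\<^sub>E UNIV D. \<forall>i. x i \<in> F i x"
proof -
  let ?L = "product_topology E UNIV"
  have L: "hausdorff_locally_convex ?L" by (rule hausdorff_locally_convex_product[OF E])
  have XL: "Pi\<^sub>E UNIV X \<subseteq> topspace ?L" using X(1) by (simp add: PiE_mono)
  have "convex (Pi\<^sub>E UNIV X)"
  proof (rule convexI)
    fix x y :: "'i \<Rightarrow> 'e" and u v :: real
    assume "x \<in> Pi\<^sub>E UNIV X" "y \<in> Pi\<^sub>E UNIV X" "0 \<le> u" "0 \<le> v" "u + v = 1"
    then show "u *\<^sub>R x + v *\<^sub>R y \<in> Pi\<^sub>E UNIV X"
      using X(2) by (auto simp: PiE_iff plus_fun_def scaleR_fun_def intro: convexD)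
  qed
  moreover have DD: "compactin ?L (Pi\<^sub>E UNIV D)" using D(3) by (simp add: compactin_PiE)
  moreover have "Pi\<^sub>E UNIV D \<subseteq> Pi\<^sub>E UNIV X" using D(1) by (simp add: PiE_mono)
  ultimately obtain C where C: "Pi\<^sub>E UNIV D \<subseteq> C" "C \<subseteq> Pi\<^sub>E UNIV X" "convex C"
    "Lindelof_space (subtopology ?L C)"
    using convex_sigma_compact_superset[OF L] by metis
  let ?S = "subtopology ?L C"
  have CL: "C \<subseteq> topspace ?L" using C(2) XL by blast
  have topS: "topspace ?S = C" using CL by auto
  have "normal_space ?S"
    by (rule regular_Lindelof_imp_normal_space[OF regular_space_subtopology[OF lcs_regular[OF L]] C(4)])
  have "\<exists>f. continuous_map ?S (E i) f \<and> (\<forall>x\<in>topspace ?S. f x \<in> F i x)" for i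
  proof (rule michael_selection_compact_metrizable[OF \<open>normal_space ?S\<close> E D(3,4)])
    fix x assume "x \<in> topspace ?S"
    then have "x \<in> Pi\<^sub>E UNIV X" using C(2) topS by blast
    then show "F i x \<noteq> {}" "F i x \<subseteq> D i" "convex (F i x)" "closedin (E i) (F i x)"
      by (rule F)+
  next
    show "lower_semicontinuous ?S (E i) (F i)"
      unfolding lower_semicontinuous_def
    proof (intro ballI allI impI)
      fix x V assume x: "x \<in> topspace ?S" and V: "openin (E i) V \<and> F i x \<inter> V \<noteq> {}"
      have "x \<in> topspace S" using x C(2) XL by (auto simp: S_def)
      then obtain U where U: "openin S U" "x \<in> U" "\<forall>y\<in>U. F i y \<inter> V \<noteq> {}"
        using lsc V unfolding lower_semicontinuous_def by meson
      then obtain G where "openin ?L G" "U = G \<inter> Pi\<^sub>E UNIV X" unfolding S_def openin_subtopology by blast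
      then have "openin ?S (G \<inter> C)" "x \<in> G \<inter> C" "\<forall>y\<in>G \<inter> C. F i y \<inter> V \<noteq> {}"
        using U x C(2) topS by (auto simp: openin_subtopology)
      then show "\<exists>U. openin ?S U \<and> x \<in> U \<and> (\<forall>y\<in>U. F i y \<inter> V \<noteq> {})" by blast
    qed
  qed
  then obtain f where f: "\<And>i. continuous_map ?S (E i) (f i)" "\<And>i x. x \<in> C \<Longrightarrow> f i x \<in> F i x"
    unfolding topS by metis
  define \<Phi> where "\<Phi> x = (\<lambda>i. f i x)" for x
  have "continuous_map ?S ?L \<Phi>"
    unfolding continuous_map_componentwise_UNIV \<Phi>_def using f(1) by simp
  moreover have "\<Phi> ` C \<subseteq> Pi\<^sub>E UNIV D"
    using f(2) F(2) C(2) unfolding \<Phi>_def by (fastforce simp: PiE_iff)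
  moreover have "C \<noteq> {}" using C(1) D(2) by (auto simp: PiE_eq_empty_iff)
  ultimately have "\<exists>x\<in>Pi\<^sub>E UNIV D. \<Phi> x = x"
    by (intro lcs_compact_map_fixed_point[OF L C(3) CL _ DD C(1)])
  then obtain x where x: "x \<in> Pi\<^sub>E UNIV D" "\<Phi> x = x" by blast
  then have "x i \<in> F i x" for i using f(2)[of x i] C(1) by (metis \<Phi>_def subsetD)
  with x(1) show ?thesis by blast
qed

section \<open>Selections on simplices\<close>

text \<open>
  Affine independence makes the parametrization by barycentric coordinates injective; a continuous
  bijection from a compact onto a Hausdorff space is a homeomorphism. Thus barycentric coordinates are
  continuous in every Hausdorff locally convex topology.
\<close>
lemma simplex_barycentric_homeomorphism:
  fixes L :: "'z::real_vector topology"
  assumes L: "hausdorff_locally_convex L" and x: "bij_betw x {1..n} C" and C: "\<not> affine_dependent C"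
    and CL: "C \<subseteq> topspace L" and KL: "convex hull C \<subseteq> topspace L"
  shows "homeomorphic_map (top_of_set (std_simplex n)) (subtopology L (convex hull C)) (\<lambda>l. \<Sum>i=1..n. l i *\<^sub>R x i)"
    (is "homeomorphic_map ?\<Delta> ?K ?\<phi>")
proof (rule continuous_imp_homeomorphic_map)
  have injx: "inj_on x {1..n}" and Cx: "x ` {1..n} = C" using x by (simp_all add: bij_betw_def)
  have finC: "finite C" using Cx by auto
  show "compact_space ?\<Delta>" by (simp add: compact_space_subtopology compact_std_simplex)
  show "Hausdorff_space ?K" by (simp add: Hausdorff_space_subtopology lcs_Hausdorff[OF L])
  have img: "?\<phi> ` std_simplex n = convex hull C"
  proof
    have "x i \<in> convex hull C" if "i \<in> {1..n}" for i using that Cx hull_subset[of C convex] by blast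
    then show "?\<phi> ` std_simplex n \<subseteq> convex hull C"
      by (auto simp: std_simplex_def intro!: convex_sum)
    show "convex hull C \<subseteq> ?\<phi> ` std_simplex n"
    proof
      fix p assume "p \<in> convex hull C"
      then obtain u where u: "\<forall>c\<in>C. 0 \<le> u c" "sum u C = 1" "(\<Sum>c\<in>C. u c *\<^sub>R c) = p"
        unfolding convex_hull_finite[OF finC] by blast
      \<comment> \<open>Coordinates with index outside \<open>{1..n}\<close> have to vanish in \<open>std_simplex n\<close>.\<close>
      define l where "l i = (if i \<in> {1..n} then u (x i) else 0)" for i
      have "(\<Sum>i=1..n. l i) = sum u C" "(\<Sum>i=1..n. l i *\<^sub>R x i) = (\<Sum>c\<in>C. u c *\<^sub>R c)"
        unfolding Cx[symmetric] sum.reindex[OF injx] by (simp_all add: l_def)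
      moreover have "\<forall>i. 0 \<le> l i" using u(1) Cx by (auto simp: l_def)
      ultimately have "l \<in> std_simplex n" "?\<phi> l = p" using u by (auto simp: std_simplex_def l_def)
      then show "p \<in> ?\<phi> ` std_simplex n" by blast
    qed
  qed
  then show "?\<phi> ` topspace ?\<Delta> = topspace ?K" using KL by auto
  have "continuous_map ?\<Delta> L ?\<phi>"
  proof (intro continuous_map_lcs_sum[OF L] continuous_map_lcs_scaleR[OF L])
    fix i assume "i \<in> {1..n}"
    then have "x i \<in> topspace L" using Cx CL by blast
    then show "continuous_map ?\<Delta> L (\<lambda>l. x i)" by simp
    show "continuous_map ?\<Delta> euclideanreal (\<lambda>l. l i)"
      by (simp add: continuous_on_subset[OF continuous_on_product_coordinates])
  qed simp
  then show "continuous_map ?\<Delta> ?K ?\<phi>" using img by (auto simp: continuous_map_in_subtopology)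
  show "inj_on ?\<phi> (topspace ?\<Delta>)"
  proof (rule inj_onI)
    fix l l' assume "l \<in> topspace ?\<Delta>" "l' \<in> topspace ?\<Delta>" and eq: "?\<phi> l = ?\<phi> l'"
    then have l: "l \<in> std_simplex n" "l' \<in> std_simplex n" by auto
    define U where "U c = l (inv_into {1..n} x c) - l' (inv_into {1..n} x c)" for c
    have Ux: "U (x i) = l i - l' i" if "i \<in> {1..n}" for i
      unfolding U_def inv_into_f_f[OF injx that] ..
    have "sum U C = (\<Sum>i=1..n. l i - l' i)" "(\<Sum>c\<in>C. U c *\<^sub>R c) = (\<Sum>i=1..n. (l i - l' i) *\<^sub>R x i)"
      unfolding Cx[symmetric] sum.reindex[OF injx] by (auto simp: Ux intro!: sum.cong)
    then have "sum U C = 0" "(\<Sum>c\<in>C. U c *\<^sub>R c) = 0"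
      using l eq by (simp_all add: std_simplex_def sum_subtractf scaleR_diff_left)
    then have "\<forall>c\<in>C. U c = 0" using C unfolding affine_dependent_explicit_finite[OF finC] by blast
    then have "l i = l' i" if "i \<in> {1..n}" for i using Ux[OF that] Cx that by auto
    moreover have "l i = l' i" if "i \<notin> {1..n}" for i using l that by (auto simp: std_simplex_def)
    ultimately show "l = l'" by blast
  qed
qed

text \<open>
  The quasi-concavity condition for the vertices of a simplex already describes a continuous selection; it
  only has to be read as a function of the point instead of its barycentric coordinates.
\<close>
lemma weakly_naturally_quasi_concave_selection:
  fixes L :: "'z::real_vector topology" and E :: "'y::real_vector topology"
  assumes L: "hausdorff_locally_convex L" and E: "hausdorff_locally_convex E"
    and K: "simplex_of_dim m K" "K \<subseteq> topspace L" and Y: "Y \<subseteq> topspace E"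
    and T: "weakly_naturally_quasi_concave K Y T"
  shows "compactin L K" and "\<exists>f. continuous_map (subtopology L K) E f \<and> (\<forall>p\<in>K. f p \<in> T p)"
proof -
  obtain C where C: "finite C" "card C = m + 1" "\<not> affine_dependent C" "K = convex hull C"
    using K(1) unfolding simplex_of_dim_def by blast
  define n where "n = m + 1"
  obtain x where x: "bij_betw x {1..n} C" using ex_bij_betw_nat_finite_1[OF C(1)] C(2) n_def by auto
  have CK: "C \<subseteq> K" unfolding C(4) by (rule hull_subset)
  have xK: "inj_on x {1..n}" "x ` {1..n} \<subseteq> K" using x CK by (auto simp: bij_betw_def)
  let ?\<Delta> = "top_of_set (std_simplex n)" and ?\<phi> = "\<lambda>l. \<Sum>i=1..n. l i *\<^sub>R x i"
  have hom: "homeomorphic_map ?\<Delta> (subtopology L K) ?\<phi>"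
    unfolding C(4) by (rule simplex_barycentric_homeomorphism[OF L x C(3)]) (use C(4) K(2) CK in auto)
  then obtain \<psi> where \<psi>: "homeomorphic_maps ?\<Delta> (subtopology L K) ?\<phi> \<psi>"
    unfolding homeomorphic_map_maps by blast
  have "compactin ?\<Delta> (std_simplex n)" by (simp add: compactin_subtopology compact_std_simplex)
  moreover have "continuous_map ?\<Delta> L ?\<phi>"
    using homeomorphic_imp_continuous_map[OF hom] by (rule continuous_map_into_fulltopology)
  ultimately have "compactin L (?\<phi> ` std_simplex n)" by (rule image_compactin)
  moreover have "?\<phi> ` std_simplex n = K" using homeomorphic_imp_surjective_map[OF hom] K(2) by auto
  ultimately show "compactin L K" by simp
  obtain y and g :: "nat \<Rightarrow> real \<Rightarrow> real" where y: "\<forall>i\<in>{1..n}. y i \<in> T (x i)"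
    and g: "\<forall>i\<in>{1..n}. continuous_on {0..1} (g i)"
    and gy: "\<forall>l\<in>unit_simplex n. (\<Sum>i=1..n. g i (l i) *\<^sub>R y i) \<in> T (\<Sum>i=1..n. l i *\<^sub>R x i)"
    using T[unfolded weakly_naturally_quasi_concave_def, THEN conjunct2, THEN conjunct2, THEN conjunct2,
        THEN conjunct2, THEN spec[of _ n], THEN spec[of _ x], THEN mp, OF conjI[OF xK]]
    by (elim exE conjE) (rule that, simp_all)
  have yE: "y i \<in> topspace E" if "i \<in> {1..n}" for i
    using T y xK(2) Y that unfolding weakly_naturally_quasi_concave_def by blast
  define h where "h l = (\<Sum>i=1..n. g i (l i) *\<^sub>R y i)" for l
  have "continuous_map ?\<Delta> E h"
    unfolding h_def
  proof (intro continuous_map_lcs_sum[OF E] continuous_map_lcs_scaleR[OF E])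
    fix i assume i: "i \<in> {1..n}"
    then show "continuous_map ?\<Delta> E (\<lambda>l. y i)" using yE by simp
    have "continuous_on (std_simplex n) (\<lambda>l. g i (l i))"
      by (rule continuous_on_compose2[OF bspec[OF g i]
            continuous_on_subset[OF continuous_on_product_coordinates]])
        (use std_simplex_subset_cube[of n] in auto)
    then show "continuous_map ?\<Delta> euclideanreal (\<lambda>l. g i (l i))" by simp
  qed simp
  moreover have "continuous_map (subtopology L K) ?\<Delta> \<psi>" using \<psi> by (simp add: homeomorphic_maps_def)
  ultimately have "continuous_map (subtopology L K) E (h \<circ> \<psi>)" by (rule continuous_map_compose[rotated])
  moreover have "(h \<circ> \<psi>) p \<in> T p" if p: "p \<in> K" for p
  proof -
    have pK: "p \<in> topspace (subtopology L K)" using p K(2) by auto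
    then have "\<psi> p \<in> std_simplex n" "?\<phi> (\<psi> p) = p"
      using \<psi> by (auto simp: homeomorphic_maps_def continuous_map_def)
    moreover then have "\<psi> p \<in> unit_simplex n" by (auto simp: std_simplex_def unit_simplex_def)
    ultimately show ?thesis using gy unfolding h_def by force
  qed
  ultimately show "\<exists>f. continuous_map (subtopology L K) E f \<and> (\<forall>p\<in>K. f p \<in> T p)" by blast
qed

section \<open>Equilibria of abstract economies\<close>

theorem theorem14:
  fixes E :: "'i \<Rightarrow> 'e::real_vector topology"
    and X D :: "'i \<Rightarrow> 'e set"
    and A P B :: "'i \<Rightarrow> ('i \<Rightarrow> 'e) \<Rightarrow> 'e set"
    and K :: "'i \<Rightarrow> ('i \<Rightarrow> 'e) set"
    and n :: "'i \<Rightarrow> nat"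
  defines "\<tau> \<equiv> \<lambda>i. subtopology (E i) (X i)"
  assumes "abstract_economy \<tau> A P B"
    and "\<And>i. hausdorff_locally_convex (E i)"
    and "\<And>i. X i \<subseteq> topspace (E i)"
    and "\<And>i. X i \<noteq> {}"
    and "\<And>i. convex (X i)"
    and "\<And>i. D i \<subseteq> X i"
    and "\<And>i. D i \<noteq> {}"
    and "\<And>i. compactin (\<tau> i) (D i)"
    and "\<And>i. metrizable_space (subtopology (\<tau> i) (D i))"
    and "\<And>i x. x \<in> Pi\<^sub>E UNIV X \<Longrightarrow> A i x \<subseteq> D i \<and> P i x \<subseteq> D i \<and> B i x \<subseteq> D i"
    and "\<And>i. lower_semicontinuous (product_topology \<tau> UNIV) (\<tau> i) (\<lambda>x. \<tau> i closure_of B i x)"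
    and "\<And>i x. x \<in> Pi\<^sub>E UNIV X \<Longrightarrow>
           \<tau> i closure_of B i x \<noteq> {} \<and> convex (\<tau> i closure_of B i x)"
    and "\<And>i. 1 \<le> n i"
    and "\<And>i. K i \<subseteq> Pi\<^sub>E UNIV X"
    and "\<And>i. simplex_of_dim (n i - 1) (K i)"
    and "\<And>i. {x \<in> Pi\<^sub>E UNIV X. A i x \<inter> P i x \<noteq> {}} \<subseteq> product_topology \<tau> UNIV interior_of K i"
    and "\<And>i. WNQS_property i (X i) (K i) (\<lambda>x. \<tau> i closure_of B i x)"
  shows "\<exists>x. x \<in> Pi\<^sub>E UNIV D \<and> equilibrium_point \<tau> A P B x"
proof -
  note E = assms(3) and XE = assms(4) and convX = assms(6) and DX = assms(7) and D0 = assms(8)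
    and compD = assms(9) and metD = assms(10) and subD = assms(11) and lscB = assms(12)
    and clB = assms(13) and KX = assms(15) and simpK = assms(16) and intK = assms(17) and WNQS = assms(18)
  let ?L = "product_topology E UNIV" and ?X = "Pi\<^sub>E UNIV X"
  have L: "hausdorff_locally_convex ?L" by (rule hausdorff_locally_convex_product[OF E])
  have XL: "?X \<subseteq> topspace ?L" using XE by (simp add: PiE_mono)
  have prod: "product_topology \<tau> UNIV = subtopology ?L ?X"
    by (simp add: \<tau>_def subtopology_product_topology)
  have topX: "topspace (product_topology \<tau> UNIV) = ?X" unfolding prod using XL by auto
  have compDE: "compactin (E i) (D i)" for i using compD by (simp add: \<tau>_def compactin_subtopology)
  have metDE: "metrizable_space (subtopology (E i) (D i))" for i
    using metD[of i] DX[of i] by (simp add: \<tau>_def subtopology_subtopology inf.absorb2)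
  have Hausd: "Hausdorff_space (\<tau> i)" for i
    by (simp add: \<tau>_def Hausdorff_space_subtopology lcs_Hausdorff[OF E])
  define cB where "cB i x = \<tau> i closure_of B i x" for i x
  have cBD: "cB i x \<subseteq> D i" if "x \<in> ?X" for i x
    unfolding cB_def using subD[OF that, of i] compactin_imp_closedin[OF Hausd compD]
    by (intro closure_of_minimal) auto
  have cBclosed: "closedin (E i) (cB i x)" if x: "x \<in> ?X" for i x
  proof -
    have "compactin (\<tau> i) (cB i x)"
      using closed_compactin[OF compD cBD[OF x]] by (simp add: cB_def)
    then have "compactin (E i) (cB i x)" by (simp add: \<tau>_def compactin_subtopology)
    then show ?thesis by (rule compactin_imp_closedin[OF lcs_Hausdorff[OF E]])
  qed
  have "\<exists>f. compactin ?L (K i) \<and> continuous_map (subtopology ?L (K i)) (E i) f \<and>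
          (\<forall>x\<in>K i. f x \<in> cB i x \<and> f x \<noteq> x i)" for i
  proof -
    obtain T where T: "weakly_naturally_quasi_concave (K i) (X i) T" "\<forall>x\<in>K i. x i \<notin> T x \<and> T x \<subseteq> cB i x"
      using WNQS[of i] unfolding WNQS_property_def cB_def by blast
    have "K i \<subseteq> topspace ?L" using KX XL by blast
    then show ?thesis
      using weakly_naturally_quasi_concave_selection[OF L E simpK _ XE T(1)] T(2) by (metis subsetD)
  qed
  then obtain f where compK: "\<And>i. compactin ?L (K i)"
    and contf: "\<And>i. continuous_map (subtopology ?L (K i)) (E i) (f i)"
    and f: "\<And>i x. x \<in> K i \<Longrightarrow> f i x \<in> cB i x" "\<And>i x. x \<in> K i \<Longrightarrow> f i x \<noteq> x i"
    by metis
  \<comment> \<open>On \<open>K i\<close> the value is shrunk to one point different from \<open>x i\<close>, which excludes fixed points there.\<close>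
  define F where "F i x = (if x \<in> K i then {f i x} else cB i x)" for i x
  have FcB: "F i x \<subseteq> cB i x" for i x using f(1) by (auto simp: F_def)
  have "\<exists>x\<in>Pi\<^sub>E UNIV D. \<forall>i. x i \<in> F i x"
  proof (rule lsc_family_fixed_point[OF E XE convX DX D0 compDE metDE])
    fix i x assume x: "x \<in> ?X"
    show "F i x \<noteq> {}" "convex (F i x)" using clB[OF x] by (auto simp: F_def cB_def)
    show FD: "F i x \<subseteq> D i" using FcB cBD[OF x] by blast
    show "closedin (E i) (F i x)"
    proof (cases "x \<in> K i")
      case True
      have "f i x \<in> topspace (E i)" using f(1)[OF True] cBD[OF x] DX XE by blast
      then show ?thesis using True
        by (simp add: F_def closedin_Hausdorff_singleton lcs_Hausdorff[OF E])
    next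
      case False
      then show ?thesis using cBclosed[OF x] by (simp add: F_def)
    qed
  next
    fix i
    show "lower_semicontinuous (subtopology ?L ?X) (E i) (F i)"
      unfolding lower_semicontinuous_def prod[symmetric] topX
    proof (intro ballI allI impI)
      fix x V assume x: "x \<in> ?X" and V: "openin (E i) V \<and> F i x \<inter> V \<noteq> {}"
      have "openin (\<tau> i) (V \<inter> X i)" using V by (auto simp: \<tau>_def openin_subtopology)
      moreover have "cB i x \<inter> (V \<inter> X i) \<noteq> {}" using V FcB cBD[OF x] DX by blast
      ultimately obtain U where U: "openin (product_topology \<tau> UNIV) U" "x \<in> U" "\<forall>y\<in>U. cB i y \<inter> (V \<inter> X i) \<noteq> {}"
        using lscB[of i] x unfolding lower_semicontinuous_def topX cB_def by meson
      \<comment> \<open>Continuity of \<open>f i\<close> gives \<open>G\<close> when \<open>x \<in> K i\<close>; otherwise \<open>G\<close> avoids the closed set \<open>K i\<close>.\<close>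
      obtain G where G: "openin ?L G" "x \<in> G" "\<And>y. y \<in> G \<Longrightarrow> y \<in> K i \<Longrightarrow> f i y \<in> V"
      proof (cases "x \<in> K i")
        case True
        have "openin (subtopology ?L (K i)) {y \<in> topspace (subtopology ?L (K i)). f i y \<in> V}"
          by (rule openin_continuous_map_preimage[OF contf]) (use V in blast)
        then obtain G where G: "openin ?L G" "{y \<in> topspace (subtopology ?L (K i)). f i y \<in> V} = G \<inter> K i"
          unfolding openin_subtopology by blast
        have "f i x \<in> V" using V True by (simp add: F_def)
        then have "x \<in> G \<inter> K i" unfolding G(2)[symmetric] using True x XL by auto
        then show thesis using that[of G] G by blast
      next
        case False
        have "closedin ?L (K i)" by (rule compactin_imp_closedin[OF lcs_Hausdorff[OF L] compK])
        then show thesis using that[of "topspace ?L - K i"] False x XL by blast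
      qed
      have "openin (product_topology \<tau> UNIV) (G \<inter> ?X)" unfolding prod using G(1) by (auto simp: openin_subtopology)
      then have "openin (product_topology \<tau> UNIV) (U \<inter> (G \<inter> ?X))" using U(1) by (rule openin_Int[rotated])
      moreover have "x \<in> U \<inter> (G \<inter> ?X)" using U(2) G(2) x by blast
      moreover have "F i y \<inter> V \<noteq> {}" if "y \<in> U \<inter> (G \<inter> ?X)" for y
        using that U(3) G(3) by (auto simp: F_def)
      ultimately show "\<exists>U. openin (product_topology \<tau> UNIV) U \<and> x \<in> U \<and> (\<forall>y\<in>U. F i y \<inter> V \<noteq> {})" by blast
    qed
  qed
  then obtain x where x: "x \<in> Pi\<^sub>E UNIV D" "\<And>i. x i \<in> F i x" by blast
  have xX: "x \<in> ?X" using x(1) DX PiE_mono[of UNIV D X] by blast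
  have notK: "x \<notin> K i" for i using x(2)[of i] f(2)[of x i] by (auto simp: F_def)
  have "A i x \<inter> P i x = {}" for i
    using intK[of i] xX notK[of i] interior_of_subset[of "product_topology \<tau> UNIV" "K i"] by blast
  moreover have "x i \<in> \<tau> i closure_of B i x" for i using x(2)[of i] notK[of i] by (simp add: F_def cB_def)
  ultimately have "equilibrium_point \<tau> A P B x" using xX topX by (simp add: equilibrium_point_def)
  with x(1) show ?thesis by blast
qed

end
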